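(* Let $\mathcal{I}$ be a metric space, $d\ge1$, and let $\boldsymbol{S}\colon\mathcal{I}\to\mathbb{C}^{d\times d}$, $i\mapsto S_i$, be continuous and bounded with $\rho(\boldsymbol{S})=1$. Let $\varLambda\subset\varSigma_{\mathcal{I}}^+$ be a nonempty compact set invariant under the one-sided shift $\theta_+$. Then the following are equivalent: (a) $S_{i_n}\cdots S_{i_1}\to \mathbf{0}_{d\times d}$ as $n\to\infty$ for every $i(\cdot)=(i_n)_{n\ge1}\in\varLambda$; (b) $\rho(\boldsymbol{S}_{\upharpoonright\varLambda})<1$; (c) there exist a constant $0<\gamma<1$ and an integer $N\ge1$ such that $\rho(S_{i_n}\cdots S_{i_1})\le\gamma$ for all $n\ge N$ and all $i(\cdot)\in\varLambda$.
   Context: $\varSigma_{\mathcal{I}}^+$ is the set of one-sided sequences $i(\cdot)=(i_n)_{n=1}^\infty$ in $\mathcal{I}$ with the product topology; $\theta_+$ is the shift $(i_n)_{n\ge1}\mapsto(i_{n+1})_{n\ge1}$. $\rho(A)$ denotes the spectral radius of a matrix $A$. The (unconstrained) generalized spectral radius is $\rho(\boldsymbol{S})=\limsup_{n\to\infty}\sup_{(i_1,\dots,i_n)\in\mathcal{I}^n}\rho(S_{i_n}\cdots S_{i_1})^{1/n}$, and the constrained one is $\rho(\boldsymbol{S}_{\upharpoonright\varLambda})=\limsup_{n\to\infty}\sup_{i(\cdot)\in\varLambda}\rho(S_{i_n}\cdots S_{i_1})^{1/n}$. *)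

theory Defs
  imports "HOL-Analysis.Analysis"
begin

definition spec_rad :: "complex^'d^'d \<Rightarrow> real" where
  "spec_rad A = Max (norm ` {c. \<exists>v. v \<noteq> 0 \<and> A *v v = c *s v})"

text \<open>One-sided sequences i(.) = (i_1, i_2, ...) are functions nat => 'i, with
  omega 0 = i_1. The type nat => 'i carries the product topology (Function_Topology).\<close>
definition shift_plus :: "(nat \<Rightarrow> 'i) \<Rightarrow> (nat \<Rightarrow> 'i)" where
  "shift_plus w = (\<lambda>n. w (Suc n))"

primrec prodm :: "('i \<Rightarrow> complex^'d^'d) \<Rightarrow> (nat \<Rightarrow> 'i) \<Rightarrow> nat \<Rightarrow> complex^'d^'d" where
  "prodm S w 0 = mat 1"
| "prodm S w (Suc n) = S (w n) ** prodm S w n"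

definition gen_spec_rad :: "('i \<Rightarrow> complex^'d^'d) \<Rightarrow> (nat \<Rightarrow> 'i) set \<Rightarrow> ereal" where
  "gen_spec_rad S L =
     limsup (\<lambda>n. SUP w\<in>L. ereal (spec_rad (prodm S w n) powr (1 / real n)))"

end

theory Submission
  imports Defs "HOL-Computational_Algebra.Fundamental_Theorem_Algebra" "HOL-Library.Ramsey"
begin

text \<open>
  The hard implication is from (c) to (a). Every product of the family has spectral radius at
  most \<open>1\<close>, since otherwise its powers would push the generalized spectral radius above \<open>1\<close>.
  Let \<open>V\<close> be an invariant subspace on which the products along \<open>\<Lambda>\<close> decay exponentially, and \<open>W\<close> a minimal
  invariant subspace properly above it. The products act irreducibly on the quotient and
  have bounded traces there; as in Burnside's theorem the algebra they generate contains an
  operator of rank one, and pairing with it turns the trace bound into a norm bound. So the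
  products on the quotient form a bounded semigroup. If they did not tend to \<open>0\<close> along some sequence
  in \<open>\<Lambda>\<close>, Ramsey's theorem would give long subwords whose products converge to a nonzero
  idempotent; this contradicts (c), because \<open>\<bar>det (1 - A)\<bar> \<ge> (1 - \<gamma>) ^ d\<close> when the spectral radius of
  \<open>A\<close> is at most \<open>\<gamma> \<le> 1\<close>. By compactness of \<open>\<Lambda>\<close> the decay on the quotient is uniformly exponential, and
  Duhamel's formula transfers it to \<open>W\<close>. Hence the maximal such \<open>V\<close> is the whole space.
\<close>

section \<open>Characteristic polynomial and trace\<close>

text \<open>Vieta's formulas for the two leading coefficients; roots form a multiset so that
  multiplicities count. The second coefficient later identifies a trace with a sum of
  eigenvalues.\<close>

lemma coeff_prod_linear_factors:
  fixes A :: "'a::idom multiset"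
  shows "degree (\<Prod>x\<in>#A. [:- x, 1:]) = size A"
    and "coeff (\<Prod>x\<in>#A. [:- x, 1:]) (size A) = 1"
    and "size A = Suc n \<Longrightarrow> coeff (\<Prod>x\<in>#A. [:- x, 1:]) n = - sum_mset A"
proof -
  have *: "degree (\<Prod>x\<in>#A. [:- x, 1:]) = size A \<and> coeff (\<Prod>x\<in>#A. [:- x, 1:]) (size A) = 1" for A :: "'a multiset"
  proof (induction A)
    case (add x A)
    let ?q = "\<Prod>x\<in>#A. [:- x, 1:]"
    have "?q \<noteq> 0" using add by (metis coeff_0 zero_neq_one)
    then have "degree ([:- x, 1:] * ?q) = Suc (size A)"
      using add by (subst degree_mult_eq) auto
    moreover have "coeff ?q (Suc (size A)) = 0"
      using add by (intro coeff_eq_0) simp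
    then have "coeff ([:- x, 1:] * ?q) (Suc (size A)) = 1"
      using add by simp
    ultimately show ?case by simp
  qed simp
  show "degree (\<Prod>x\<in>#A. [:- x, 1:]) = size A" "coeff (\<Prod>x\<in>#A. [:- x, 1:]) (size A) = 1"
    using * by auto
  show "size A = Suc n \<Longrightarrow> coeff (\<Prod>x\<in>#A. [:- x, 1:]) n = - sum_mset A"
  proof (induction A arbitrary: n)
    case (add x A)
    have 1: "coeff (\<Prod>x\<in>#A. [:- x, 1:]) n = 1" using add.prems *[of A] by simp
    show ?case
    proof (cases n)
      case 0
      then have "A = {#}" using add by simp
      then show ?thesis using 0 by simp
    next
      case (Suc m)
      then have "coeff (\<Prod>x\<in>#A. [:- x, 1:]) m = - sum_mset A" using add by simp
      then show ?thesis using 1 Suc by simp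
    qed
  qed simp
qed

text \<open>In the Leibniz expansion of the characteristic polynomial a permutation other than the
  identity moves at least two indices, so its term has degree at most d - 2. The two leading
  coefficients therefore come from the diagonal product, and comparing them with those of the
  factorization gives the trace.\<close>

lemma det_char_matrix_factorization:
  fixes M :: "complex^'d^'d"
  obtains A where "\<And>z. det (mat z - M) = (\<Prod>x\<in>#A. z - x)"
    and "trace M = sum_mset A" and "size A = CARD('d)"
proof -
  define C :: "complex poly^'d^'d" where
    "C = (\<chi> i j. if i = j then [:- (M$i$j), 1:] else [:- (M$i$j):])"
  define p where "p = det C"
  define D where "D = image_mset (\<lambda>i. M$i$i) (mset_set (UNIV :: 'd set))"
  define R where "R = (\<Sum>\<sigma> | \<sigma> permutes (UNIV::'d set) \<and> \<sigma> \<noteq> id. of_int (sign \<sigma>) * (\<Prod>i\<in>UNIV. C$i$\<sigma> i))"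
  have sD: "size D = CARD('d)" by (simp add: D_def)
  obtain n where n: "CARD('d) = Suc n" by (metis zero_less_card_finite gr0_conv_Suc)
  have pol: "poly p z = det (mat z - M)" for z
    unfolding p_def det_def poly_sum poly_mult poly_prod of_int_poly poly_of_int
    by (intro sum.cong prod.cong refl arg_cong2[of _ _ _ _ "(*)"])
       (auto simp: C_def mat_def)
  have split: "p = (\<Prod>x\<in>#D. [:- x, 1:]) + R"
  proof -
    have "{\<sigma>. \<sigma> permutes (UNIV::'d set)} = insert id {\<sigma>. \<sigma> permutes (UNIV::'d set) \<and> \<sigma> \<noteq> id}"
      by (auto simp: permutes_id)
    then have "p = (\<Prod>i\<in>UNIV. C$i$i) + R"
      unfolding p_def det_def R_def by (simp add: finite_permutations)
    also have "(\<Prod>i\<in>UNIV. C$i$i) = (\<Prod>x\<in>#D. [:- x, 1:])"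
      by (simp add: D_def C_def prod_unfold_prod_mset image_mset.compositionality o_def)
    finally show ?thesis .
  qed
  have Rc: "coeff R k = 0" if "k \<ge> n" for k
  proof -
    have "coeff (of_int (sign \<sigma>) * (\<Prod>i\<in>UNIV. C$i$\<sigma> i)) k = 0"
      if \<sigma>: "\<sigma> permutes (UNIV::'d set)" "\<sigma> \<noteq> id" for \<sigma>
    proof -
      \<comment> \<open>Both \<open>i\<close> and \<open>\<sigma> i\<close> are moved, so the
        entries of \<open>C\<close> in these two rows are constants.\<close>
      obtain i where i: "\<sigma> i \<noteq> i" using \<sigma> by (metis eq_id_iff)
      then have i2: "\<sigma> (\<sigma> i) \<noteq> \<sigma> i" using \<sigma> by (metis permutes_inj injD)
      have "degree (\<Prod>i\<in>UNIV. C$i$\<sigma> i) \<le> (\<Sum>i\<in>UNIV. degree (C$i$\<sigma> i))"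
        using degree_prod_sum_le[of UNIV "\<lambda>i. C$i$\<sigma> i"] by (simp add: o_def)
      also have "\<dots> \<le> (\<Sum>j\<in>UNIV. if j = i \<or> j = \<sigma> i then 0 else 1)"
        using i i2 by (intro sum_mono) (auto simp: C_def)
      also have "\<dots> = card (UNIV - {i, \<sigma> i})"
        by (subst card_eq_sum, rule sum.mono_neutral_cong_right) auto
      also have "\<dots> < n"
      proof -
        have "card {i, \<sigma> i} \<le> CARD('d)" by (intro card_mono) auto
        then show ?thesis using i n by (subst card_Diff_subset) auto
      qed
      finally have *: "degree (\<Prod>i\<in>UNIV. C$i$\<sigma> i) < k" using that \<open>k \<ge> n\<close> by simp
      then show ?thesis
        by (simp add: of_int_poly coeff_eq_0)
    qed
    then show ?thesis unfolding R_def coeff_sum by (intro sum.neutral) auto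
  qed
  have c1: "coeff p (Suc n) = 1"
    using coeff_prod_linear_factors(2)[of D] sD n Rc[of "Suc n"] by (simp add: split)
  have c2: "coeff p n = - trace M"
    using coeff_prod_linear_factors(3)[of D n] sD n Rc[of n]
    by (simp add: split D_def trace_def sum_unfold_sum_mset)
  have dp: "degree p = Suc n"
  proof (rule antisym)
    show "degree p \<le> Suc n"
    proof (rule degree_le, intro allI impI)
      fix k assume "Suc n < k"
      then show "coeff p k = 0" using Rc[of k] coeff_prod_linear_factors(1)[of D] sD n
        by (simp add: split coeff_eq_0)
    qed
    show "Suc n \<le> degree p" using c1 by (intro le_degree) simp
  qed
  have "p \<noteq> 0" using dp by auto
  then obtain A where A: "size A = degree p" "p = smult (lead_coeff p) (\<Prod>x\<in>#A. [:- x, 1:])"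
    using alg_closed_imp_factorization by blast
  then have pA: "p = (\<Prod>x\<in>#A. [:- x, 1:])" using c1 dp by simp
  have "det (mat z - M) = (\<Prod>x\<in>#A. z - x)" for z
    unfolding pol[symmetric] pA by (simp add: poly_prod_mset image_mset.compositionality o_def)
  moreover have "trace M = sum_mset A"
    using c2 coeff_prod_linear_factors(3)[of A n] A(1) dp pA by simp
  ultimately show ?thesis using that A(1) dp n by simp
qed

definition is_eigval :: "complex^'d^'d \<Rightarrow> complex \<Rightarrow> bool" where
  "is_eigval M c \<longleftrightarrow> (\<exists>v. v \<noteq> 0 \<and> M *v v = c *s v)"

lemma mat_vector_mult: "mat c *v x = c *s (x :: 'a::semiring_1^'d)"
proof -
  have "(\<Sum>j\<in>UNIV. (if i = j then c else 0) * x $ j) = (\<Sum>j\<in>UNIV. if i = j then c * x $ j else 0)" for i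
    by (intro sum.cong) auto
  then show ?thesis by (simp add: vec_eq_iff matrix_vector_mult_def mat_def)
qed

lemma is_eigval_iff_det: "is_eigval M c \<longleftrightarrow> det (mat c - M) = 0"
proof -
  have "det (mat c - M) \<noteq> 0 \<longleftrightarrow> (\<forall>x. (mat c - M) *v x = 0 \<longrightarrow> x = 0)"
    by (metis invertible_det_nz invertible_left_inverse matrix_left_invertible_ker)
  also have "\<dots> \<longleftrightarrow> \<not> is_eigval M c"
    by (auto simp: is_eigval_def matrix_vector_mult_diff_rdistrib mat_vector_mult)
  finally show ?thesis by blast
qed

lemma eigval_multiset:
  fixes M :: "complex^'d^'d"
  obtains A where "\<And>z. det (mat z - M) = (\<Prod>x\<in>#A. z - x)"
    and "trace M = sum_mset A" and "size A = CARD('d)" and "set_mset A = {c. is_eigval M c}"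
proof -
  obtain A where A: "\<And>z. det (mat z - M) = (\<Prod>x\<in>#A. z - x)"
    "trace M = sum_mset A" "size A = CARD('d)"
    using det_char_matrix_factorization by blast
  have "set_mset A = {c. is_eigval M c}"
    by (auto simp: is_eigval_iff_det A(1) prod_mset_zero_iff)
  then show ?thesis using that A by blast
qed

lemma finite_eigvals: "finite {c. is_eigval M c}"
  by (metis eigval_multiset finite_set_mset)

lemma ex_eigval: "\<exists>c. is_eigval (M :: complex^'d^'d) c"
proof -
  obtain A where "size A = CARD('d)" "set_mset A = {c. is_eigval M c}"
    using eigval_multiset[of M] by metis
  then show ?thesis by (metis size_empty set_mset_eq_empty_iff Collect_empty_eq zero_less_card_finite less_irrefl)
qed

lemma spec_rad_le_iff: "spec_rad M \<le> r \<longleftrightarrow> (\<forall>c. is_eigval M c \<longrightarrow> norm c \<le> r)"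
proof -
  have "spec_rad M = Max (norm ` {c. is_eigval M c})"
    by (simp add: spec_rad_def is_eigval_def)
  moreover have "norm ` {c. is_eigval M c} \<noteq> {}" using ex_eigval[of M] by auto
  ultimately show ?thesis using finite_eigvals[of M] by (auto simp: Max_le_iff)
qed

lemma norm_eigval_le_spec_rad: "is_eigval M c \<Longrightarrow> norm c \<le> spec_rad M"
  using spec_rad_le_iff[of M "spec_rad M"] by simp

lemma spec_rad_nonneg: "0 \<le> spec_rad M"
  using ex_eigval[of M] norm_eigval_le_spec_rad norm_ge_zero order_trans by blast

lemma norm_sum_mset_le:
  fixes A :: "'a::real_normed_vector multiset"
  assumes "\<And>x. x \<in># A \<Longrightarrow> norm x \<le> r"
  shows "norm (sum_mset A) \<le> size A * r"
  using assms
proof (induction A)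
  case (add x A)
  have "norm (sum_mset A) \<le> size A * r" using add by simp
  moreover have "norm x \<le> r" using add.prems by simp
  ultimately show ?case using norm_triangle_ineq[of x "sum_mset A"]
    by (simp add: algebra_simps)
qed simp

lemma norm_trace_le:
  fixes M :: "complex^'d^'d"
  assumes "spec_rad M \<le> r"
  shows "norm (trace M) \<le> CARD('d) * r"
proof -
  obtain A where A: "trace M = sum_mset A" "size A = CARD('d)" "set_mset A = {c. is_eigval M c}"
    using eigval_multiset[of M] by metis
  then show ?thesis using assms norm_sum_mset_le[of A r] by (simp add: spec_rad_le_iff)
qed

text \<open>Each factor 1 - x of the determinant has modulus at least 1 - r. Since the determinant
  is continuous, such a bound survives limits and keeps 1 from becoming an eigenvalue of the
  limit.\<close>

lemma norm_det_one_minus_ge: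
  fixes M :: "complex^'d^'d"
  assumes "spec_rad M \<le> r" "r \<le> 1"
  shows "(1 - r) ^ CARD('d) \<le> norm (det (mat 1 - M))"
proof -
  obtain A where A: "det (mat 1 - M) = (\<Prod>x\<in>#A. 1 - x)" "size A = CARD('d)"
    "set_mset A = {c. is_eigval M c}"
    using eigval_multiset[of M] by metis
  have "\<And>x. x \<in># A \<Longrightarrow> norm x \<le> r" using assms A by (simp add: spec_rad_le_iff)
  then have "(1 - r) ^ size A \<le> norm (\<Prod>x\<in>#A. 1 - x)"
  proof (induction A)
    case (add x A)
    have "1 - r \<le> norm (1 - x)" using add.prems[of x] norm_triangle_ineq2[of 1 x] by simp
    moreover have "(1 - r) ^ size A \<le> norm (\<Prod>x\<in>#A. 1 - x)" using add by simp
    ultimately show ?case using assms(2) by (simp add: norm_mult mult_mono)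
  qed simp
  then show ?thesis using A by simp
qed

text \<open>All eigenvalues are 0 or 1 and the eigenvalue 1 occurs, so the real part of their sum is
  positive.\<close>

lemma trace_idempotent_nonzero:
  fixes M :: "complex^'d^'d"
  assumes "M ** M = M" "M \<noteq> 0"
  shows "trace M \<noteq> 0"
proof -
  obtain A where A: "trace M = sum_mset A" "set_mset A = {c. is_eigval M c}"
    using eigval_multiset[of M] by metis
  have idem: "M *v (M *v x) = M *v x" for x
    by (simp add: matrix_vector_mul_assoc assms(1))
  have ev: "c = 0 \<or> c = 1" if c: "is_eigval M c" for c
  proof -
    obtain v where v: "v \<noteq> 0" "M *v v = c *s v" using c by (auto simp: is_eigval_def)
    then have "c *s (c *s v) = c *s v" using idem[of v] by (simp add: vec.scale)
    then show ?thesis using v(1) by (simp add: vec.scale_cancel_right)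
  qed
  obtain x where "M *v x \<noteq> 0" using assms(2) by (metis matrix_eq matrix_vector_mult_0)
  then have "is_eigval M 1" unfolding is_eigval_def using idem[of x] by (intro exI[of _ "M *v x"]) simp
  then obtain B where B: "A = add_mset 1 B" using A(2) by (metis mem_Collect_eq multi_member_split)
  have "0 \<le> Re (sum_mset B)" if "\<And>x. x \<in># B \<Longrightarrow> x = 0 \<or> x = 1" for B :: "complex multiset"
    using that by (induction B) force+
  moreover have "\<And>x. x \<in># B \<Longrightarrow> x = 0 \<or> x = 1" using ev A(2) B by (metis insertI2 mem_Collect_eq set_mset_add_mset_insert)
  ultimately have "0 \<le> Re (sum_mset B)" by blast
  then have "0 < Re (trace M)" by (simp add: A(1) B)
  then show ?thesis by auto
qed

section \<open>Projections, invariant subspaces and compressions\<close>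

text \<open>Extend a basis of \<open>V\<close> to one of \<open>W\<close>, send the vectors of the
  former to 0 and fix the added ones. This represents the quotient of \<open>W\<close> by
  \<open>V\<close> by matrices of the original size, so no change of type is needed.\<close>

lemma ex_projection_modulo:
  fixes V W :: "('a::field^'d) set"
  assumes "vec.subspace V" "vec.subspace W" "V \<subseteq> W"
  obtains P :: "'a^'d^'d" where "\<And>x. P *v x \<in> W" and "\<And>x. x \<in> W \<Longrightarrow> x - P *v x \<in> V"
    and "\<And>x. x \<in> V \<Longrightarrow> P *v x = 0" and "P ** P = P"
proof -
  obtain B where B: "B \<subseteq> V" "vec.independent B" "V \<subseteq> vec.span B"
    using vec.basis_exists by metis
  obtain C where C: "B \<subseteq> C" "C \<subseteq> W" "vec.independent C" "W \<subseteq> vec.span C"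
    using vec.maximal_independent_subset_extend[of B W] B assms by (metis subset_trans)
  obtain g where g: "Vector_Spaces.linear (*s) (*s) g"
    "\<And>x. x \<in> C \<Longrightarrow> g x = (if x \<in> B then 0 else x)"
    \<comment> \<open>Controlling the range on the whole space, not only on \<open>W\<close>, makes
      \<open>g\<close> map everything into \<open>W\<close> and be idempotent everywhere.\<close>
    "range g = vec.span ((\<lambda>x. if x \<in> B then 0 else x) ` C)"
    using vec.linear_independent_extend_subspace[OF C(3), of "\<lambda>x. if x \<in> B then 0 else x"] by blast
  interpret g: Vector_Spaces.linear "(*s)" "(*s)" g by (rule g(1))
  define P where "P = matrix g"
  have P: "P *v x = g x" for x unfolding P_def using g(1) by (simp add: matrix_works)
  have gW: "g x \<in> W" for x
  proof -
    have "g x \<in> vec.span ((\<lambda>x. if x \<in> B then 0 else x) ` C)" using g(3) by auto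
    moreover have "\<dots> \<subseteq> W" using C(2) assms(2) vec.subspace_0 by (intro vec.span_minimal) auto
    ultimately show ?thesis by blast
  qed
  have gV: "g x = 0" if "x \<in> V" for x
  proof (rule g.eq_0_on_span)
    show "x \<in> vec.span B" using that B(3) by blast
    show "g b = 0" if "b \<in> B" for b using that C(1) g(2)[of b] by auto
  qed
  have gd: "x - g x \<in> V" if "x \<in> W" for x
  proof -
    have "x \<in> vec.span C" using that C by auto
    then show ?thesis
    proof (induction rule: vec.span_induct)
      case base
      have eqs: "x + y - g (x + y) = (x - g x) + (y - g y)" "c *s x - g (c *s x) = c *s (x - g x)" for x y c
        by (simp_all add: g.add g.scale vec.scale_right_diff_distrib)
      show ?case
      proof (rule vec.subspaceI)
        show "0 \<in> {x. x - g x \<in> V}" using vec.subspace_0[OF assms(1)] by (simp add: g.zero)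
      next
        fix x y assume "x \<in> {x. x - g x \<in> V}" "y \<in> {x. x - g x \<in> V}"
        then show "x + y \<in> {x. x - g x \<in> V}"
          unfolding mem_Collect_eq eqs by (rule vec.subspace_add[OF assms(1)])
      next
        fix c x assume "x \<in> {x. x - g x \<in> V}"
        then show "c *s x \<in> {x. x - g x \<in> V}"
          unfolding mem_Collect_eq eqs by (rule vec.subspace_scale[OF assms(1)])
      qed
    next
      case (step x)
      then show ?case using g(2)[of x] B(1) vec.subspace_0[OF assms(1)] by (cases "x \<in> B") auto
    qed
  qed
  have "g (g x) = g x" for x
  proof -
    have "g x \<in> vec.span ((\<lambda>x. if x \<in> B then 0 else x) ` C)" using g(3) by blast
    then show ?thesis
    proof (induction rule: vec.span_induct)
      case base
      show ?case unfolding vec.subspace_def by (simp add: g.zero g.add g.scale)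
    next
      case (step x)
      then obtain y where "y \<in> C" "x = (if y \<in> B then 0 else y)" by blast
      then show ?case using g(2)[of y] g.zero by (cases "y \<in> B") auto
    qed
  qed
  then have "P ** P = P" by (simp add: matrix_eq matrix_vector_mul_assoc[symmetric] P)
  then show ?thesis using that[of P] P gW gV gd by simp
qed

text \<open>The restriction of \<open>B\<close> to \<open>R\<close> is replaced by a full-size
  matrix built with a projection \<open>P\<close> onto \<open>R\<close>. Without an eigenvector in
  \<open>R\<close>, the traces of these matrices would force \<open>trace P = 0\<close>.\<close>

lemma ex_eigvec_in_invariant_subspace:
  fixes B :: "complex^'d^'d"
  assumes R: "vec.subspace R" "\<And>x. x \<in> R \<Longrightarrow> B *v x \<in> R" "R \<noteq> {0}"
  obtains v c where "v \<in> R" "v \<noteq> 0" "B *v v = c *s v"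
proof -
  have "vec.subspace {0 :: complex^'d}" by simp
  then obtain P :: "complex^'d^'d" where P: "\<And>x. P *v x \<in> R" "\<And>x. x \<in> R \<Longrightarrow> x - P *v x \<in> {0}" "P ** P = P"
    using ex_projection_modulo[of "{0}" R] R(1) vec.subspace_0[OF R(1)]
    by (metis empty_subsetI insert_subset)
  have PR: "P *v x = x" if "x \<in> R" for x using P(2)[OF that] by simp
  have "P \<noteq> 0"
  proof
    assume "P = 0"
    then have "R \<subseteq> {0}" using PR by auto
    then show False using R(3) vec.subspace_0[OF R(1)] by auto
  qed
  then have trP: "trace P \<noteq> 0" using trace_idempotent_nonzero P(3) by blast
  note goal = that
  show ?thesis
  proof (rule ccontr)
    assume "\<not> thesis"
    then have no: "v = 0" if "v \<in> R" "B *v v = c *s v" for v c using goal[of v c] that by blast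
    \<comment> \<open>Extend the restriction of \<open>B\<close> to \<open>R\<close> by the scalar \<open>t\<close> on the kernel of \<open>P\<close>:
      then \<open>t\<close> would be the only eigenvalue, which fixes the trace for every \<open>t\<close>.\<close>
    have tr: "trace (B ** P + mat t ** (mat 1 - P)) = of_nat CARD('d) * t" for t
    proof -
      let ?M = "B ** P + mat t ** (mat 1 - P)"
      obtain A where A: "trace ?M = sum_mset A" "size A = CARD('d)" "set_mset A = {c. is_eigval ?M c}"
        using eigval_multiset[of ?M] by metis
      have ev: "c = t" if c: "is_eigval ?M c" for c
      proof (rule ccontr)
        assume "c \<noteq> t"
        obtain v where v: "v \<noteq> 0" "?M *v v = c *s v" using c by (auto simp: is_eigval_def)
        \<comment> \<open>Applying \<open>P\<close> to the eigenvector equation shows that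
          \<open>P *v v\<close> would be an eigenvector of \<open>B\<close> in \<open>R\<close>
          unless it vanishes; if it vanishes, \<open>?M\<close> acts on \<open>v\<close> as the
          scalar \<open>t\<close>.\<close>
        have Mv: "?M *v v = B *v (P *v v) + t *s (v - P *v v)"
          by (simp add: matrix_vector_mult_add_rdistrib matrix_vector_mul_assoc[symmetric]
              mat_vector_mult matrix_vector_mult_diff_rdistrib)
        have "P *v (?M *v v) = B *v (P *v v)"
          unfolding Mv using PR[OF R(2)[OF P(1)], of v] PR[OF P(1), of v]
          by (simp add: matrix_vector_right_distrib vec.scale matrix_vector_mult_diff_distrib)
        then have "c *s (P *v v) = B *v (P *v v)" using v by (simp add: vec.scale)
        then have "P *v v = 0" using no[OF P(1)] by metis
        then have "c *s v = t *s v" using Mv v(2) by simp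
        then show False using \<open>c \<noteq> t\<close> v(1) by (simp add: vec.scale_cancel_right)
      qed
      have "sum_mset A = of_nat (size A) * t" if "\<And>x. x \<in># A \<Longrightarrow> x = t" for A :: "complex multiset"
        using that by (induction A) (auto simp: algebra_simps)
      from this[of A] show ?thesis using A ev by auto
    qed
    \<comment> \<open>The values t = 0 and t = 1 together give \<open>trace P = 0\<close>,
      impossible for a nonzero idempotent.\<close>
    have "trace (B ** P) = 0" using tr[of 0] by (simp add: mat_0 trace_0)
    moreover have "trace (B ** P + (mat 1 - P)) = of_nat CARD('d)" using tr[of 1] by simp
    ultimately show False using trP by (simp add: trace_add trace_sub trace_I)
  qed
qed

text \<open>Put \<open>v\<close> into a basis of \<open>R\<close>: the images of the other basis
  vectors already span the image of \<open>R\<close>.\<close>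

lemma dim_image_less:
  fixes N :: "'a::field^'n^'m"
  assumes R: "vec.subspace R" and v: "v \<in> R" "v \<noteq> 0" "N *v v = 0"
  shows "vec.dim ((*v) N ` R) < vec.dim R"
proof -
  have "vec.independent {v}" using v(2) by simp
  then obtain B where B: "{v} \<subseteq> B" "B \<subseteq> R" "vec.independent B" "R \<subseteq> vec.span B"
    using vec.maximal_independent_subset_extend[of "{v}" R] v(1) by blast
  have fin: "finite B" using B(3) by (rule vec.finiteI_independent)
  have "(*v) N ` R \<subseteq> vec.span ((*v) N ` B)"
    using image_mono[OF B(4)] by (simp add: vec.span_image)
  also have "\<dots> \<subseteq> vec.span ((*v) N ` (B - {v}))"
  proof (intro vec.span_minimal image_subsetI)
    fix x assume "x \<in> B"
    then show "N *v x \<in> vec.span ((*v) N ` (B - {v}))"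
      using v(3) by (cases "x = v") (auto intro: vec.span_base vec.span_zero)
  qed simp
  finally have "vec.dim ((*v) N ` R) \<le> card ((*v) N ` (B - {v}))"
    using fin by (intro vec.dim_le_card) auto
  also have "\<dots> \<le> card (B - {v})" using fin by (intro card_image_le) auto
  also have "\<dots> < card B" using B(1) fin by (intro psubset_card_mono) auto
  also have "card B = vec.dim R" using B by (intro vec.basis_card_eq_dim)
  finally show ?thesis .
qed

text \<open>An eigenvector x of the compression for c \<noteq> 0 satisfies P x = x and (M - c) x
  \<in> V. If c were no eigenvalue of \<open>M\<close>, then M - c would be injective and, by
  dimension, map \<open>V\<close> onto itself; so x would lie in \<open>V\<close>, which
  \<open>P\<close> kills.\<close>

lemma eigval_compression:
  fixes M P :: "complex^'d^'d"
  assumes V: "vec.subspace V" "\<And>x. x \<in> V \<Longrightarrow> M *v x \<in> V"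
    and W: "\<And>x. x \<in> W \<Longrightarrow> M *v x \<in> W"
    and P: "\<And>x. P *v x \<in> W" "\<And>x. x \<in> W \<Longrightarrow> x - P *v x \<in> V"
      "\<And>x. x \<in> V \<Longrightarrow> P *v x = 0" "P ** P = P"
    and c: "is_eigval (P ** M ** P) c" "c \<noteq> 0"
  shows "is_eigval M c"
proof (rule ccontr)
  assume no: "\<not> is_eigval M c"
  obtain x where x: "x \<noteq> 0" "P *v (M *v (P *v x)) = c *s x"
    using c(1) by (auto simp: is_eigval_def matrix_vector_mul_assoc[symmetric])
  have "P *v (P *v z) = P *v z" for z by (simp add: matrix_vector_mul_assoc P(4))
  then have "P *v (c *s x) = c *s x" unfolding x(2)[symmetric] by blast
  then have Px: "P *v x = x" using c(2) by (simp add: vec.scale)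
  define f where "f = (*v) (M - mat c)"
  have f: "f y = M *v y - c *s y" for y
    by (simp add: f_def matrix_vector_mult_diff_rdistrib mat_vector_mult)
  have lin: "Vector_Spaces.linear (*s) (*s) f" by (simp add: f_def)
  have inj: "inj f" unfolding f_def using no
    by (subst vec.inj_iff_eq_0) (auto simp: is_eigval_def matrix_vector_mult_diff_rdistrib mat_vector_mult)
  have "f ` V \<subseteq> V" using V by (auto simp: f intro!: vec.subspace_diff vec.subspace_scale)
  moreover have "vec.dim (f ` V) = vec.dim V"
    using vec.dim_image_eq[OF lin, of V] inj inj_on_subset by blast
  moreover have "vec.subspace (f ` V)" using V(1) unfolding f_def by (rule vec.subspace_image)
  ultimately have "f ` V = V" using V(1) vec.subspace_dim_equal[of "f ` V" V] by simp
  moreover have "f x \<in> V"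
  proof -
    have "x \<in> W" using P(1)[of x] Px by simp
    then show ?thesis using P(2)[OF W, of x] x(2) Px by (simp add: f)
  qed
  ultimately have "x \<in> V" using inj by (metis (no_types, lifting) image_iff injD)
  then show False using P(3) Px x(1) by simp
qed

section \<open>Irreducible semigroups with bounded trace\<close>

lemma norm_sum_mult_le_L2_set:
  fixes a b :: "'i::finite \<Rightarrow> complex"
  shows "norm (\<Sum>j\<in>UNIV. a j * b j) \<le> L2_set (\<lambda>j. norm (a j)) UNIV * L2_set (\<lambda>j. norm (b j)) UNIV"
proof -
  have "norm (\<Sum>j\<in>UNIV. a j * b j) \<le> (\<Sum>j\<in>UNIV. \<bar>norm (a j)\<bar> * \<bar>norm (b j)\<bar>)"
    by (rule order_trans[OF norm_sum]) (simp add: norm_mult)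
  also have "\<dots> \<le> L2_set (\<lambda>j. norm (a j)) UNIV * L2_set (\<lambda>j. norm (b j)) UNIV"
    by (rule L2_set_mult_ineq)
  finally show ?thesis .
qed

lemma norm_matrix_vector_mult_le:
  fixes M :: "complex^'n^'m"
  shows "norm (M *v x) \<le> norm M * norm x"
proof -
  have "norm (M *v x) \<le> L2_set (\<lambda>i. norm (M $ i) * norm x) UNIV"
    unfolding norm_vec_def[of "M *v x"]
    by (rule L2_set_mono) (auto simp: matrix_vector_mult_def norm_vec_def intro: norm_sum_mult_le_L2_set)
  also have "\<dots> = norm M * norm x"
    by (simp add: L2_set_left_distrib norm_vec_def[of M])
  finally show ?thesis .
qed

text \<open>The norm of the matrix type is the Frobenius norm; its square is a sum over columns, and
  each column of the product is \<open>M\<close> applied to a column of \<open>N\<close>.\<close>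

lemma norm_matrix_matrix_mult_le:
  fixes M :: "complex^'n^'m" and N :: "complex^'k^'n"
  shows "norm (M ** N) \<le> norm M * norm N"
proof -
  have sq: "(norm X)\<^sup>2 = (\<Sum>i\<in>UNIV. (norm (transpose X $ i))\<^sup>2)" for X :: "complex^'a^'b"
    by (simp add: norm_vec_def L2_set_def sum_nonneg transpose_def) (rule sum.swap)
  have col: "transpose (M ** N) $ i = M *v (transpose N $ i)" for i
    by (simp add: vec_eq_iff transpose_def matrix_matrix_mult_def matrix_vector_mult_def)
  have "(norm (M ** N))\<^sup>2 = (\<Sum>i\<in>UNIV. (norm (M *v (transpose N $ i)))\<^sup>2)"
    unfolding sq col ..
  also have "\<dots> \<le> (\<Sum>i\<in>UNIV. (norm M * norm (transpose N $ i))\<^sup>2)"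
    by (intro sum_mono power_mono norm_matrix_vector_mult_le norm_ge_zero)
  also have "\<dots> = (norm M * norm N)\<^sup>2"
    by (simp add: power_mult_distrib sq[of N] sum_distrib_left)
  finally show ?thesis by (rule power2_le_imp_le) simp
qed

lemma mat_mult_nth:
  fixes M :: "'a::comm_semiring_1^'n^'m"
  shows "(mat c ** M) $ i $ j = c * M $ i $ j" "(M ** mat c) $ i $ j = c * M $ i $ j"
proof -
  have "(\<Sum>k\<in>UNIV. (if i = k then c else 0) * M $ k $ j) = (\<Sum>k\<in>UNIV. if i = k then c * M $ k $ j else 0)"
    by (intro sum.cong) auto
  then show "(mat c ** M) $ i $ j = c * M $ i $ j"
    by (simp add: matrix_matrix_mult_def mat_def)
  have "(\<Sum>k\<in>UNIV. M $ i $ k * (if k = j then c else 0)) = (\<Sum>k\<in>UNIV. if k = j then c * M $ i $ k else 0)"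
    by (intro sum.cong) (auto simp: mult.commute)
  then show "(M ** mat c) $ i $ j = c * M $ i $ j"
    by (simp add: matrix_matrix_mult_def mat_def)
qed

lemma scaleR_matrix_eq: "r *\<^sub>R M = mat (of_real r) ** (M :: complex^'n^'m)"
  by (simp add: vec_eq_iff mat_mult_nth) (simp add: scaleR_conv_of_real)

lemma matrix_add_rdistrib: "(A + B) ** C = A ** C + B ** (C :: 'a::semiring_1^'k^'n)"
  by (simp add: vec_eq_iff matrix_matrix_mult_def sum.distrib distrib_right)

lemma bounded_bilinear_matrix_matrix_mult:
  "bounded_bilinear ((**) :: complex^'n^'m \<Rightarrow> complex^'k^'n \<Rightarrow> complex^'k^'m)"
proof (rule bounded_bilinear.intro)
  show "\<exists>K. \<forall>a b. norm ((a :: complex^'n^'m) ** (b :: complex^'k^'n)) \<le> norm a * norm b * K"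
    using norm_matrix_matrix_mult_le by (intro exI[of _ 1]) auto
qed (simp_all add: matrix_add_ldistrib matrix_add_rdistrib vec_eq_iff matrix_matrix_mult_def
    sum_distrib_left scaleR_sum_right sum.distrib algebra_simps)

lemmas tendsto_matrix_mult = bounded_bilinear.tendsto[OF bounded_bilinear_matrix_matrix_mult]

lemma tendsto_trace: "(f \<longlongrightarrow> l) F \<Longrightarrow> ((\<lambda>x. trace (f x :: complex^'n^'n)) \<longlongrightarrow> trace l) F"
  unfolding trace_def by (intro tendsto_sum tendsto_vec_nth)

lemma spec_rad_le_norm: "spec_rad M \<le> norm M"
proof -
  have "norm c \<le> norm M" if c: "is_eigval M c" for c
  proof -
    obtain v where v: "v \<noteq> 0" "M *v v = c *s v" using c by (auto simp: is_eigval_def)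
    have "norm (c *s v) = norm c * norm v"
      by (simp add: norm_vec_def norm_mult L2_set_right_distrib)
    then have "norm c * norm v \<le> norm M * norm v"
      using norm_matrix_vector_mult_le[of M v] v by simp
    then show ?thesis using v(1) by simp
  qed
  then show ?thesis by (simp add: spec_rad_le_iff)
qed

lemma trace_scale: "trace (mat c ** M) = c * trace (M :: complex^'n^'n)"
  by (simp add: trace_def sum_distrib_left mat_mult_nth)

lemma mat_commute: "mat c ** M = M ** mat (c :: complex)"
  by (simp add: vec_eq_iff mat_mult_nth)

section \<open>The algebra generated by a semigroup of matrices\<close>

text \<open>This is only a linear span; it is an algebra once \<open>H\<close> is closed under
  products. The identity matrix is not put in, since the semigroups below may have a proper
  projection as their unit.\<close>

inductive_set generated_algebra :: "(complex^'d^'d) set \<Rightarrow> (complex^'d^'d) set" for H where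
  base: "A \<in> H \<Longrightarrow> A \<in> generated_algebra H"
| add: "A \<in> generated_algebra H \<Longrightarrow> B \<in> generated_algebra H \<Longrightarrow> A + B \<in> generated_algebra H"
| scale: "A \<in> generated_algebra H \<Longrightarrow> mat c ** A \<in> generated_algebra H"

lemma generated_algebra_mult:
  assumes H: "\<And>A B. A \<in> H \<Longrightarrow> B \<in> H \<Longrightarrow> A ** B \<in> H"
    and "A \<in> generated_algebra H" "B \<in> generated_algebra H"
  shows "A ** B \<in> generated_algebra H"
  using assms(2)
proof induction
  case (base A)
  show ?case using assms(3)
  proof induction
    case (scale B c)
    have "A ** (mat c ** B) = mat c ** (A ** B)" by (metis mat_commute matrix_mul_assoc)
    then show ?case using scale generated_algebra.scale by metis
  qed (use base H in \<open>auto simp: matrix_add_ldistrib intro: generated_algebra.intros\<close>)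
qed (auto simp: matrix_add_rdistrib matrix_mul_assoc[symmetric] intro: generated_algebra.intros)

lemma generated_algebra_unit:
  assumes "\<And>h. h \<in> H \<Longrightarrow> E ** h = h" "\<And>h. h \<in> H \<Longrightarrow> h ** E = h" "A \<in> generated_algebra H"
  shows "E ** A = A" "A ** E = A"
  using assms(3)
proof induction
  case (scale A c)
  { case 1 show ?case using scale by (metis mat_commute matrix_mul_assoc) }
  { case 2 show ?case using scale by (metis matrix_mul_assoc) }
qed (auto simp: assms matrix_add_ldistrib matrix_add_rdistrib)

text \<open>The trace bound extends by linearity. The constant depends on \<open>A\<close>, but it
  is uniform in the semigroup element \<open>g\<close>.\<close>

lemma trace_mult_generated_algebra_bounded:
  assumes "\<And>g h. g \<in> H \<Longrightarrow> h \<in> H \<Longrightarrow> norm (trace (g ** h)) \<le> K" "A \<in> generated_algebra H"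
  shows "\<exists>C. \<forall>g\<in>H. norm (trace (g ** A)) \<le> C"
  using assms(2)
proof induction
  case (base A)
  then show ?case using assms(1) by blast
next
  case (add A B)
  then obtain C D where CD: "\<forall>g\<in>H. norm (trace (g ** A)) \<le> C" "\<forall>g\<in>H. norm (trace (g ** B)) \<le> D" by blast
  have "norm (trace (g ** (A + B))) \<le> C + D" if "g \<in> H" for g
    using CD that norm_triangle_ineq[of "trace (g ** A)" "trace (g ** B)"]
    by (fastforce simp: matrix_add_ldistrib trace_add)
  then show ?case by blast
next
  case (scale A c)
  then obtain C where C: "\<forall>g\<in>H. norm (trace (g ** A)) \<le> C" by blast
  have "norm (trace (g ** (mat c ** A))) \<le> norm c * C" if "g \<in> H" for g
  proof -
    have "g ** (mat c ** A) = mat c ** (g ** A)" by (metis mat_commute matrix_mul_assoc)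
    then show ?thesis using C that by (simp add: trace_scale norm_mult mult_left_mono)
  qed
  then show ?case by blast
qed

text \<open>The core of Burnside's theorem: take a nonzero \<open>T\<close> of least rank in the
  algebra. If its rank exceeded one, transitivity would give an \<open>A\<close> for which
  subtracting an eigenvalue from T A and multiplying by \<open>T\<close> yields a nonzero element of
  smaller rank.\<close>

lemma ex_rank_one_in_generated_algebra:
  fixes H :: "(complex^'d^'d) set"
  assumes E: "E \<in> H" "E \<noteq> 0" and unit: "\<And>h. h \<in> H \<Longrightarrow> E ** h = h" "\<And>h. h \<in> H \<Longrightarrow> h ** E = h"
    and mult: "\<And>g h. g \<in> H \<Longrightarrow> h \<in> H \<Longrightarrow> g ** h \<in> H"
    and trans: "\<And>x y. x \<noteq> 0 \<Longrightarrow> E *v x = x \<Longrightarrow> E *v y = y \<Longrightarrow> \<exists>A\<in>generated_algebra H. A *v x = y"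
  obtains T u where "T \<in> generated_algebra H" "u \<noteq> 0" "u \<in> range ((*v) T)" "\<And>x. \<exists>c. T *v x = c *s u"
proof -
  obtain T where T: "T \<in> generated_algebra H" "T \<noteq> 0"
    and min: "\<And>X. X \<in> generated_algebra H \<Longrightarrow> X \<noteq> 0 \<Longrightarrow> vec.dim (range ((*v) T)) \<le> vec.dim (range ((*v) X))"
    using ex_has_least_nat[of "\<lambda>X. X \<in> generated_algebra H \<and> X \<noteq> 0" E "\<lambda>X. vec.dim (range ((*v) X))"] E generated_algebra.base by blast
  have un: "E ** X = X" "X ** E = X" if "X \<in> generated_algebra H" for X
    using generated_algebra_unit[of H E X] unit that by blast+
  obtain z where z: "T *v z \<noteq> 0" using T(2) by (metis matrix_eq matrix_vector_mult_0)
  have ET: "E *v (T *v x) = T *v x" "T *v (E *v x) = T *v x" for x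
    using un[OF T(1)] by (simp_all add: matrix_vector_mul_assoc)
  have "\<exists>c. T *v x = c *s (T *v z)" for x
  proof (rule ccontr)
    assume no: "\<nexists>c. T *v x = c *s (T *v z)"
    have "E *v (E *v x) = E *v x" using unit(1)[OF E(1)] by (simp add: matrix_vector_mul_assoc)
    then obtain A where A: "A \<in> generated_algebra H" "A *v (T *v z) = E *v x" using trans[OF z ET(1)] by blast
    let ?R = "range ((*v) T)"
    have R: "vec.subspace ?R" by (simp add: vec.subspace_image)
    have "?R \<noteq> {0}" using z by auto
    moreover have "(T ** A) *v y \<in> ?R" for y by (simp add: matrix_vector_mul_assoc[symmetric])
    ultimately obtain v c where v: "v \<in> ?R" "v \<noteq> 0" "(T ** A) *v v = c *s v"
      using ex_eigvec_in_invariant_subspace[OF R] by metis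
    \<comment> \<open>\<open>N ** T\<close> is nonzero, but its rank is smaller than that of \<open>T\<close> because \<open>N\<close> kills \<open>v\<close>.\<close>
    define N where "N = T ** A - mat c"
    have N: "N *v y = T *v (A *v y) - c *s y" for y
      by (simp add: N_def matrix_vector_mult_diff_rdistrib matrix_vector_mul_assoc mat_vector_mult)
    \<comment> \<open>\<open>N\<close> contains a scalar matrix and need not lie in the algebra;
      after multiplication by \<open>T\<close> the scalar acts on \<open>T\<close>, which
      does.\<close>
    have NT: "N ** T = T ** A ** T + mat (-c) ** T"
      by (simp add: matrix_eq matrix_vector_mult_add_rdistrib matrix_vector_mul_assoc[symmetric] N mat_vector_mult)
    have "N ** T \<in> generated_algebra H" unfolding NT by (intro generated_algebra.add generated_algebra.scale generated_algebra_mult mult T A)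
    moreover have "(N ** T) *v z \<noteq> 0"
      using no A(2) ET(2) by (auto simp: matrix_vector_mul_assoc[symmetric] N)
    then have "N ** T \<noteq> 0" by auto
    ultimately have ge: "vec.dim ?R \<le> vec.dim (range ((*v) (N ** T)))" by (rule min)
    have rNT: "range ((*v) (N ** T)) = (*v) N ` ?R" by (auto simp: matrix_vector_mul_assoc[symmetric] image_image)
    have "N *v v = 0" using v(3) by (simp add: N matrix_vector_mul_assoc)
    then have "vec.dim ((*v) N ` ?R) < vec.dim ?R" by (rule dim_image_less[OF R v(1,2)])
    then show False using ge[unfolded rNT] by linarith
  qed
  then show ?thesis using that[of T "T *v z"] T z by blast
qed

text \<open>If \<open>H\<close> were unbounded, normalized elements would converge to some Z of norm
  1. Traces against a fixed element of the algebra stay bounded while the norms grow, so Z is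
  trace-orthogonal to the algebra. A rank-one element and transitivity turn Z into a nonzero
  idempotent whose trace would then vanish.\<close>

lemma bounded_irreducible_semigroup:
  fixes H :: "(complex^'d^'d) set"
  assumes E: "E \<in> H" and unit: "\<And>h. h \<in> H \<Longrightarrow> E ** h = h" "\<And>h. h \<in> H \<Longrightarrow> h ** E = h"
    and mult: "\<And>g h. g \<in> H \<Longrightarrow> h \<in> H \<Longrightarrow> g ** h \<in> H"
    and trans: "\<And>x y. x \<noteq> 0 \<Longrightarrow> E *v x = x \<Longrightarrow> E *v y = y \<Longrightarrow> \<exists>A\<in>generated_algebra H. A *v x = y"
    and tr: "\<And>g. g \<in> H \<Longrightarrow> norm (trace g) \<le> K"
  shows "bounded H"
proof (cases "E = 0")
  case True
  then have "H \<subseteq> {0}" using unit(1) by force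
  then show ?thesis by (rule bounded_subset[rotated]) simp
next
  case False
  obtain T u where T: "T \<in> generated_algebra H" "u \<noteq> 0" "u \<in> range ((*v) T)" "\<And>x. \<exists>c. T *v x = c *s u"
    by (rule ex_rank_one_in_generated_algebra[OF E False unit mult trans]) (assumption | blast)+
  have un: "E ** X = X" "X ** E = X" if "X \<in> generated_algebra H" for X
    using generated_algebra_unit[of H E X] unit that by blast+
  obtain z where z: "T *v z = u" using T(3) by auto
  have Tz: "T *v (E *v z) = u" using un(2)[OF T(1)] z by (simp add: matrix_vector_mul_assoc)
  have EE: "E *v (E *v x) = E *v x" for x using unit(1)[OF E] by (simp add: matrix_vector_mul_assoc)
  have Eu: "E *v u = u" using un(1)[OF T(1)] z by (metis matrix_vector_mul_assoc)
  show ?thesis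
  proof (rule ccontr)
    assume "\<not> bounded H"
    then have "\<exists>h\<in>H. norm h > real k" for k by (meson bounded_iff not_le)
    then obtain h where h: "\<And>k. h k \<in> H" "\<And>k. norm (h k) > real k" by metis
    define f where "f k = h k /\<^sub>R norm (h k)" for k
    have hpos: "norm (h k) > 0" for k using h(2)[of k] by (meson le_less_trans of_nat_0_le_iff)
    have "f k \<in> sphere 0 1" for k using hpos[of k] by (simp add: f_def)
    then obtain Z r where Z: "Z \<in> sphere 0 1" "strict_mono r" "(f \<circ> r) \<longlonglongrightarrow> Z"
      using compact_sphere[of "0 :: complex^'d^'d" 1] unfolding compact_def by blast
    have trZ: "trace (Z ** X) = 0" if X: "X \<in> generated_algebra H" for X
    proof -
      obtain C where C: "\<And>g. g \<in> H \<Longrightarrow> norm (trace (g ** X)) \<le> C"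
        using trace_mult_generated_algebra_bounded[of H K X] mult tr X by blast
      have "(\<lambda>k. trace ((f \<circ> r) k ** X)) \<longlonglongrightarrow> trace (Z ** X)"
        by (intro tendsto_trace tendsto_matrix_mult Z tendsto_const)
      moreover have "(\<lambda>k. trace ((f \<circ> r) k ** X)) \<longlonglongrightarrow> 0"
      proof (rule Lim_null_comparison)
        have bd: "norm (trace (f k ** X)) \<le> C / real k" if "k > 0" for k
        proof -
          have "f k ** X = mat (of_real (inverse (norm (h k)))) ** (h k ** X)"
            by (simp add: f_def scaleR_matrix_eq matrix_mul_assoc)
          then have "norm (trace (f k ** X)) = norm (trace (h k ** X)) / norm (h k)"
            by (simp add: trace_scale norm_mult norm_inverse divide_inverse)
          also have "\<dots> \<le> C / real k"
            using C[OF h(1), of k] h(2)[of k] that norm_ge_zero[of "trace (h k ** X)"]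
            by (intro frac_le) linarith+
          finally show ?thesis .
        qed
        have "\<forall>\<^sub>F k in sequentially. 0 < r k"
          using eventually_compose_filterlim[OF eventually_gt_at_top filterlim_subseq[OF Z(2)]] .
        then show "\<forall>\<^sub>F k in sequentially. norm (trace ((f \<circ> r) k ** X)) \<le> C / real (r k)"
          by (rule eventually_mono) (simp add: bd)
        show "(\<lambda>k. C / real (r k)) \<longlonglongrightarrow> 0"
          using LIMSEQ_subseq_LIMSEQ[OF lim_const_over_n[of C] Z(2)] by (simp add: o_def)
      qed
      ultimately show ?thesis by (rule LIMSEQ_unique)
    qed
    have ZE: "E ** Z = Z" "Z ** E = Z"
    proof -
      have Ef: "E ** (f \<circ> r) k = (f \<circ> r) k" "(f \<circ> r) k ** E = (f \<circ> r) k" for k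
        using unit(1)[OF h(1)[of "r k"]] unit(2)[OF h(1)[of "r k"]]
        by (simp_all add: f_def scaleR_matrix_eq) (metis mat_commute matrix_mul_assoc)+
      have "(\<lambda>k. E ** (f \<circ> r) k) \<longlonglongrightarrow> E ** Z" "(\<lambda>k. (f \<circ> r) k ** E) \<longlonglongrightarrow> Z ** E"
        by (intro tendsto_matrix_mult Z tendsto_const)+
      then show "E ** Z = Z" "Z ** E = Z"
        using LIMSEQ_unique[OF Z(3)] unfolding Ef by (metis comp_def)+
    qed
    have "Z \<noteq> 0" using Z(1) by auto
    then obtain x where x: "Z *v x \<noteq> 0" by (metis matrix_eq matrix_vector_mult_0)
    obtain C where C: "C \<in> generated_algebra H" "C *v u = E *v x" using trans[OF T(2) Eu EE] by blast
    have "E *v (Z *v x) = Z *v x" by (simp add: matrix_vector_mul_assoc ZE)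
    then obtain B where B: "B \<in> generated_algebra H" "B *v (Z *v x) = E *v z" using trans[OF x _ EE] by blast
    \<comment> \<open>Along E z, the factors act as E z to u to E x, then to Z x and back to E z.
      Hence \<open>M\<close> fixes E z and maps everything to multiples of it.\<close>
    define M where "M = B ** (Z ** (C ** T))"
    have Mv: "M *v y = B *v (Z *v (C *v (T *v y)))" for y
      by (simp add: M_def matrix_vector_mul_assoc)
    have "Z *v (C *v u) = Z *v x" using C(2) ZE(2) by (simp add: matrix_vector_mul_assoc)
    then have BZC: "B *v (Z *v (C *v u)) = E *v z" using B(2) by simp
    then have Mz: "M *v (E *v z) = E *v z" by (simp add: Mv Tz)
    have "M *v (M *v y) = M *v y" for y
    proof -
      obtain c where "T *v y = c *s u" using T(4) by blast
      then have "M *v y = c *s (E *v z)" by (simp add: Mv vec.scale BZC)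
      then show ?thesis by (simp add: vec.scale Mz)
    qed
    then have "M ** M = M" by (simp add: matrix_eq matrix_vector_mul_assoc[symmetric])
    moreover have "M \<noteq> 0" using Mz Tz T(2) by auto
    ultimately have "trace M \<noteq> 0" by (rule trace_idempotent_nonzero)
    \<comment> \<open>Cyclicity of the trace moves \<open>B\<close> to the right, leaving Z times an
      element of the algebra.\<close>
    moreover have "trace M = trace (Z ** (C ** T ** B))"
      unfolding M_def by (subst trace_mul_sym) (simp add: matrix_mul_assoc)
    moreover have "C ** T ** B \<in> generated_algebra H" by (intro generated_algebra_mult mult C T B)
    ultimately show False using trZ by simp
  qed
qed

section \<open>Bounded products with small spectral radius\<close>

lemma prodm_add: "prodm S w (m + n) = prodm S (\<lambda>k. w (m + k)) n ** prodm S w m"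
  by (induction n) (simp_all add: matrix_mul_assoc)

lemma shift_invariant:
  assumes "shift_plus ` L \<subseteq> L" "w \<in> L"
  shows "(\<lambda>k. w (m + k)) \<in> L"
proof (induction m)
  case (Suc m)
  have "(\<lambda>k. w (Suc m + k)) = shift_plus (\<lambda>k. w (m + k))" by (simp add: shift_plus_def)
  then show ?case using Suc assms(1) by auto
qed (use assms in simp)

lemma norm_prodm_le:
  fixes S :: "'i \<Rightarrow> complex^'d^'d"
  assumes "\<And>i. norm (S i) \<le> B" "1 \<le> B"
  shows "norm (prodm S w n) \<le> norm (mat 1 :: complex^'d^'d) * B ^ n"
proof (induction n)
  case (Suc n)
  have "norm (prodm S w (Suc n)) \<le> norm (S (w n)) * norm (prodm S w n)"
    by (simp add: norm_matrix_matrix_mult_le)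
  also have "\<dots> \<le> B * (norm (mat 1 :: complex^'d^'d) * B ^ n)"
    using Suc assms(1)[of "w n"] assms(2) by (intro mult_mono) auto
  finally show ?case by (simp add: mult_ac)
qed simp

lemma continuous_on_prodm:
  assumes "continuous_on UNIV (S :: 'i::metric_space \<Rightarrow> complex^'d^'d)"
  shows "continuous_on UNIV (\<lambda>w. prodm S w n)"
proof (induction n)
  case (Suc n)
  have "continuous_on UNIV (\<lambda>w :: nat \<Rightarrow> 'i. S (w n))"
    by (rule continuous_on_compose2[OF assms]) auto
  then show ?case
    using Suc by (auto intro: bounded_bilinear.continuous_on[OF bounded_bilinear_matrix_matrix_mult])
qed simp

lemma tendsto_det:
  "(f \<longlongrightarrow> l) F \<Longrightarrow> ((\<lambda>x. det (f x :: complex^'n^'n)) \<longlongrightarrow> det l) F"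
  unfolding det_def by (intro tendsto_sum tendsto_mult tendsto_prod tendsto_const tendsto_vec_nth)

text \<open>By Ramsey's theorem, applied to a colouring of pairs by the cells of a fine finite cover,
  some three factors \<open>A = P a b\<close>, \<open>P b c\<close> and \<open>P a c = P b c ** A\<close> nearly coincide.\<close>

lemma ex_almost_idempotent:
  fixes P :: "nat \<Rightarrow> nat \<Rightarrow> complex^'d^'d"
  assumes cocycle: "\<And>a b c. a < b \<Longrightarrow> b < c \<Longrightarrow> P a c = P b c ** P a b"
    and bound: "\<And>a b. a < b \<Longrightarrow> norm (P a b) \<le> K" and "0 < e"
  shows "\<exists>a b. a + N < b \<and> norm (P a b ** P a b - P a b) < e"
proof -
  have K: "0 \<le> K" using bound[of 0 1] norm_ge_zero order_trans zero_less_one by blast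
  \<comment> \<open>Chosen so that the final error \<open>2 * \<delta> * K + 2 * \<delta>\<close>
    equals \<open>e\<close>.\<close>
  define \<delta> where "\<delta> = e / (2 * K + 2)"
  have \<delta>: "0 < \<delta>" using \<open>0 < e\<close> K by (simp add: \<delta>_def)
  obtain T where T: "finite T" "cball (0 :: complex^'d^'d) K \<subseteq> (\<Union>x\<in>T. ball x \<delta>)"
    using compact_cball[of "0 :: complex^'d^'d" K] \<delta> unfolding compact_eq_totally_bounded by meson
  obtain h where h: "bij_betw h {0..<card T} T" using ex_bij_betw_nat_finite[OF T(1)] by blast
  have col: "\<exists>i<card T. P a b \<in> ball (h i) \<delta>" if ab: "a < b" for a b
  proof -
    have "P a b \<in> cball 0 K" using bound[OF ab] by simp
    then obtain x where "x \<in> T" "P a b \<in> ball x \<delta>" using T(2) by blast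
    then show ?thesis using h by (metis atLeastLessThan_iff bij_betw_iff_bijections)
  qed
  \<comment> \<open>The colour of a pair is the index of a ball containing its product;
    \<open>Min\<close> and \<open>Max\<close> recover the order of the two positions.\<close>
  define f where "f X = (SOME i. i < card T \<and> P (Min X) (Max X) \<in> ball (h i) \<delta>)" for X
  have f: "f {a, b} < card T \<and> P a b \<in> ball (h (f {a, b})) \<delta>" if "a < b" for a b
    using someI_ex[OF col[OF that]] that by (simp add: f_def min_def max_def)
  have "\<forall>x\<in>UNIV. \<forall>y\<in>UNIV. x \<noteq> y \<longrightarrow> f {x, y} < card T"
    using f by (metis insert_commute nat_neq_iff)
  from Ramsey2[OF infinite_UNIV_nat this]
  obtain Y t where Y: "infinite Y" "\<forall>x\<in>Y. \<forall>y\<in>Y. x \<noteq> y \<longrightarrow> f {x, y} = t"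
    by blast
  have near: "dist (h t) (P a b) < \<delta>" if "a \<in> Y" "b \<in> Y" "a < b" for a b
    using f[OF that(3)] Y(2) that by auto
  obtain a where a: "a \<in> Y" using Y(1) by (metis ex_in_conv finite.emptyI)
  obtain b where b: "b \<in> Y" "a + N < b" using Y(1) by (metis infinite_nat_iff_unbounded)
  obtain c where c: "c \<in> Y" "b < c" using Y(1) by (metis infinite_nat_iff_unbounded)
  let ?A = "P a b" and ?B = "P b c"
  have AB: "norm (?A - ?B) < 2 * \<delta>" and AC: "norm (P a c - ?A) < 2 * \<delta>"
    using near[OF a b(1)] near[OF b(1) c] near[OF a c(1)] b(2) c(2)
      dist_triangle3[of ?A ?B "h t"] dist_triangle3[of "P a c" ?A "h t"]
    by (simp_all add: dist_norm)
  \<comment> \<open>Replacing the left factor by \<open>?B\<close> turns the square into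
    \<open>P a c\<close>, by the cocycle identity.\<close>
  have "?A ** ?A - ?A = (?A - ?B) ** ?A + (P a c - ?A)"
    using cocycle[of a b c] b(2) c(2)
    by (simp add: bounded_bilinear.diff_left[OF bounded_bilinear_matrix_matrix_mult])
  then have "norm (?A ** ?A - ?A) \<le> norm ((?A - ?B) ** ?A) + norm (P a c - ?A)"
    by (metis norm_triangle_ineq)
  also have "\<dots> < 2 * \<delta> * K + 2 * \<delta>"
  proof -
    have "norm ((?A - ?B) ** ?A) \<le> norm (?A - ?B) * norm ?A" by (rule norm_matrix_matrix_mult_le)
    also have "\<dots> \<le> 2 * \<delta> * K" using AB bound[of a b] b(2) \<delta> by (intro mult_mono) auto
    finally show ?thesis using AC by simp
  qed
  also have "\<dots> = e"
  proof -
    have "2 * \<delta> * K + 2 * \<delta> = \<delta> * (2 * K + 2)" by (simp add: algebra_simps)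
    then show ?thesis using K by (simp add: \<delta>_def)
  qed
  finally show ?thesis using b(2) by blast
qed

text \<open>A limit point is a nonzero idempotent, so it has the eigenvalue 1 and det (1 - Q) = 0.
  This contradicts the lower bound on the determinants, which passes to the limit.\<close>

lemma no_almost_idempotents:
  fixes A :: "nat \<Rightarrow> complex^'d^'d"
  assumes "\<And>k. norm (A k) \<le> K" "\<And>k. c \<le> norm (A k)" "0 < c" "\<And>k. spec_rad (A k) \<le> \<gamma>" "\<gamma> < 1"
    and lim: "(\<lambda>k. A k ** A k - A k) \<longlonglongrightarrow> 0"
  shows False
proof -
  have "\<forall>k. A k \<in> cball 0 K" using assms(1) by simp
  then obtain Q r where r: "strict_mono r" and Q: "(A \<circ> r) \<longlonglongrightarrow> Q"
    using compact_cball[of "0 :: complex^'d^'d" K] unfolding compact_def by meson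
  have "(\<lambda>k. (A \<circ> r) k ** (A \<circ> r) k - (A \<circ> r) k) \<longlonglongrightarrow> Q ** Q - Q"
    by (intro tendsto_diff tendsto_matrix_mult Q)
  moreover have "(\<lambda>k. (A \<circ> r) k ** (A \<circ> r) k - (A \<circ> r) k) \<longlonglongrightarrow> 0"
    using LIMSEQ_subseq_LIMSEQ[OF lim r] by (simp add: o_def)
  ultimately have "Q ** Q - Q = 0" by (rule LIMSEQ_unique)
  then have QQ: "Q ** Q = Q" by simp
  have "c \<le> norm Q"
    using assms(2) by (intro LIMSEQ_le_const[OF tendsto_norm[OF Q]]) auto
  then have "Q \<noteq> 0" using \<open>0 < c\<close> by auto
  then obtain x where "Q *v x \<noteq> 0" by (metis matrix_eq matrix_vector_mult_0)
  moreover have "Q *v (Q *v x) = 1 *s (Q *v x)" by (simp add: matrix_vector_mul_assoc QQ)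
  ultimately have "is_eigval Q 1" unfolding is_eigval_def by blast
  then have "det (mat 1 - Q) = 0" by (simp add: is_eigval_iff_det)
  moreover have "(1 - \<gamma>) ^ CARD('d) \<le> norm (det (mat 1 - Q))"
  proof (rule LIMSEQ_le_const)
    show "(\<lambda>k. norm (det (mat 1 - (A \<circ> r) k))) \<longlonglongrightarrow> norm (det (mat 1 - Q))"
      by (intro tendsto_norm tendsto_det tendsto_diff tendsto_const Q)
    show "\<exists>N. \<forall>n\<ge>N. (1 - \<gamma>) ^ CARD('d) \<le> norm (det (mat 1 - (A \<circ> r) n))"
      using assms(4,5) by (auto intro!: norm_det_one_minus_ge)
  qed
  moreover have "0 < (1 - \<gamma>) ^ CARD('d)" using \<open>\<gamma> < 1\<close> by simp
  ultimately show False by simp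
qed

lemma prodm_tendsto_0_of_spec_rad:
  fixes S :: "'i \<Rightarrow> complex^'d^'d"
  assumes inv: "shift_plus ` L \<subseteq> L" and bound: "\<And>w n. w \<in> L \<Longrightarrow> norm (prodm S w n) \<le> K"
    and rad: "\<And>w n. w \<in> L \<Longrightarrow> N \<le> n \<Longrightarrow> spec_rad (prodm S w n) \<le> \<gamma>" and "\<gamma> < 1" and w: "w \<in> L"
  shows "prodm S w \<longlonglongrightarrow> 0"
proof (rule ccontr)
  assume "\<not> prodm S w \<longlonglongrightarrow> 0"
  then obtain c where c: "0 < c" "\<And>n. \<exists>l\<ge>n. c \<le> norm (prodm S w l)"
    unfolding LIMSEQ_def by (auto simp: not_less)
  \<comment> \<open>\<open>P a b\<close> is the product over the positions from \<open>a\<close> up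
    to but excluding \<open>b\<close>.\<close>
  define P where "P a b = prodm S (\<lambda>k. w (a + k)) (b - a)" for a b
  have P: "P a c = P b c ** P a b" if "a < b" "b < c" for a b c
  proof -
    have "c - a = (b - a) + (c - b)" "\<And>k. a + (b - a + k) = b + k" using that by auto
    then show ?thesis unfolding P_def by (simp only: prodm_add)
  qed
  have wL: "(\<lambda>k. w (a + k)) \<in> L" for a using shift_invariant[OF inv w] .
  have PK: "norm (P a b) \<le> K" for a b unfolding P_def by (rule bound[OF wL])
  have K: "0 < K"
    using c(2)[of 0] c(1) bound[OF w] by (meson le_less_trans less_le_trans order_trans)
  \<comment> \<open>Embed the factor in a longer prefix of norm at least \<open>c\<close>; the
    pieces before and after it have norm at most \<open>K\<close> each.\<close>
  have lower: "c / K\<^sup>2 \<le> norm (P a b)" if "a < b" for a b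
  proof -
    obtain l where l: "b < l" "c \<le> norm (prodm S w l)" using c(2)[of "Suc b"] by (auto simp: Suc_le_eq)
    have "prodm S w l = P a l ** prodm S w a"
      using prodm_add[of S w a "l - a"] that l(1) by (simp add: P_def)
    then have "c \<le> norm (P a l) * norm (prodm S w a)"
      using l(2) norm_matrix_matrix_mult_le order_trans by metis
    also have "\<dots> \<le> (norm (P b l) * norm (P a b)) * K"
      using P[OF that l(1)] bound[OF w] by (intro mult_mono) (auto simp: norm_matrix_matrix_mult_le)
    also have "\<dots> \<le> (K * norm (P a b)) * K"
      using PK K by (intro mult_right_mono) auto
    finally show ?thesis using K by (simp add: field_simps power2_eq_square)
  qed
  \<comment> \<open>Factors longer than \<open>N\<close> are requested so that \<open>rad\<close>
    applies to them.\<close>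
  have "\<exists>a b. a + N < b \<and> norm (P a b ** P a b - P a b) < 1 / real (Suc k)" for k
    using P PK by (intro ex_almost_idempotent[of P K]) auto
  then obtain a b where ab: "\<And>k. a k + N < b k"
    "\<And>k. norm (P (a k) (b k) ** P (a k) (b k) - P (a k) (b k)) < 1 / real (Suc k)"
    by metis
  show False
  proof (rule no_almost_idempotents)
    show "norm (P (a k) (b k)) \<le> K" for k by (rule PK)
    show "c / K\<^sup>2 \<le> norm (P (a k) (b k))" for k using ab(1)[of k] by (intro lower) simp
    show "spec_rad (P (a k) (b k)) \<le> \<gamma>" for k
      unfolding P_def using ab(1)[of k] by (intro rad wL) simp
    show "(\<lambda>k. P (a k) (b k) ** P (a k) (b k) - P (a k) (b k)) \<longlonglongrightarrow> 0"
    proof (rule Lim_null_comparison)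
      show "\<forall>\<^sub>F k in sequentially. norm (P (a k) (b k) ** P (a k) (b k) - P (a k) (b k)) \<le> 1 / real (Suc k)"
        using ab(2) by (intro always_eventually allI less_imp_le)
      show "(\<lambda>k. 1 / real (Suc k)) \<longlonglongrightarrow> 0" using LIMSEQ_inverse_real_of_nat by (simp add: inverse_eq_divide)
    qed
  qed (use c K \<open>\<gamma> < 1\<close> in auto)
qed

section \<open>Uniform exponential decay by compactness\<close>

text \<open>By compactness, every sequence in \<open>L\<close> has an initial block of length at
  most some \<open>K\<close> whose product has norm below 1/2. Shift invariance allows splitting off
  such blocks repeatedly.\<close>

lemma uniform_exponential_decay:
  fixes S :: "'i::metric_space \<Rightarrow> complex^'d^'d"
  assumes cont: "continuous_on UNIV S" and bdd: "bounded (range S)"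
    and L: "compact L" "shift_plus ` L \<subseteq> L" and lim: "\<And>w. w \<in> L \<Longrightarrow> prodm S w \<longlonglongrightarrow> 0"
  obtains C r where "0 < C" "0 < r" "r < 1" "\<And>w n. w \<in> L \<Longrightarrow> norm (prodm S w n) \<le> C * r ^ n"
proof -
  obtain B where B: "1 \<le> B" "\<And>i. norm (S i) \<le> B"
  proof -
    obtain B where "\<And>i. norm (S i) \<le> B" using bdd by (auto simp: bounded_iff)
    then show ?thesis using that[of "max 1 B"] by (simp add: le_max_iff_disj)
  qed
  define U where "U n = {w. norm (prodm S w n) < 1/2}" for n
  have op: "open (U n)" for n
    unfolding U_def by (intro open_Collect_less continuous_on_norm continuous_on_prodm cont continuous_on_const)
  have cov: "L \<subseteq> (\<Union>n\<in>{1..}. U n)"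
  proof
    fix w assume "w \<in> L"
    then have "\<forall>\<^sub>F n in sequentially. norm (prodm S w n) < 1/2"
      using tendstoD[OF lim, of w "1/2"] by simp
    then obtain n where "\<And>k. n \<le> k \<Longrightarrow> norm (prodm S w k) < 1/2" by (auto simp: eventually_sequentially)
    \<comment> \<open>The successor keeps the block nonempty, so that splitting it off shortens the
      word in the induction below.\<close>
    then have "w \<in> U (Suc n)" by (simp add: U_def del: prodm.simps)
    then show "w \<in> (\<Union>n\<in>{1..}. U n)" by auto
  qed
  obtain D where D: "D \<subseteq> {1..}" "finite D" "L \<subseteq> (\<Union>n\<in>D. U n)"
    using compactE_image[OF L(1) op cov] by metis
  define K where "K = Suc (Max (insert 0 D))"
  have K: "\<exists>k. 1 \<le> k \<and> k \<le> K \<and> norm (prodm S w k) < 1/2" if w: "w \<in> L" for w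
  proof -
    obtain k where k: "k \<in> D" "w \<in> U k" using D(3) w by blast
    then have "k \<le> K" using D(2) by (simp add: K_def le_SucI)
    then show ?thesis using k D(1) by (auto simp: U_def)
  qed
  have "K > 0" by (simp add: K_def)
  \<comment> \<open>With this rate 1/2 \<le> r^k for every block length k \<le> K.\<close>
  define r where "r = root K (1/2)"
  have r: "0 < r" "r < 1" "r ^ K = 1/2" using \<open>K > 0\<close> by (auto simp: r_def)
  \<comment> \<open>The constant covers a final piece shorter than \<open>K\<close>; the factor 2
    compensates \<open>r ^ K = 1/2\<close>.\<close>
  define C where "C = 2 * norm (mat 1 :: complex^'d^'d) * B ^ K"
  have C: "0 < C" using B(1) by (auto simp: C_def mat_def vec_eq_iff)
  have "norm (prodm S w n) \<le> C * r ^ n" if "w \<in> L" for w n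
    using that
  proof (induction n arbitrary: w rule: less_induct)
    case (less n)
    show ?case
    proof (cases "n < K")
      case True
      have "norm (prodm S w n) \<le> norm (mat 1 :: complex^'d^'d) * B ^ n"
        using B by (intro norm_prodm_le)
      also have "\<dots> \<le> norm (mat 1 :: complex^'d^'d) * B ^ K"
        using True B(1) by (intro mult_left_mono power_increasing) auto
      also have "\<dots> = C * r ^ K" by (simp add: C_def r)
      also have "\<dots> \<le> C * r ^ n" using True r C by (intro mult_left_mono power_decreasing) auto
      finally show ?thesis .
    next
      case False
      obtain k where k: "1 \<le> k" "k \<le> K" "norm (prodm S w k) < 1/2" using K[OF less.prems] by blast
      have "prodm S w n = prodm S (\<lambda>j. w (k + j)) (n - k) ** prodm S w k"
        using prodm_add[of S w k "n - k"] k False by simp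
      then have "norm (prodm S w n) \<le> norm (prodm S (\<lambda>j. w (k + j)) (n - k)) * norm (prodm S w k)"
        by (simp add: norm_matrix_matrix_mult_le)
      also have "\<dots> \<le> (C * r ^ (n - k)) * r ^ k"
      proof (intro mult_mono)
        show "norm (prodm S (\<lambda>j. w (k + j)) (n - k)) \<le> C * r ^ (n - k)"
          using k False less.prems by (intro less.IH shift_invariant[OF L(2)]) auto
        have "r ^ K \<le> r ^ k" using k r by (intro power_decreasing) auto
        then show "norm (prodm S w k) \<le> r ^ k" using k(3) r(3) by simp
      qed (use C r in auto)
      also have "\<dots> = C * r ^ n" using k False by (simp add: mult.assoc power_add[symmetric])
      finally show ?thesis .
    qed
  qed
  then show ?thesis using that C r by blast
qed

section \<open>Passing from an invariant subspace to a larger one\<close>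

lemma prodm_cong: "(\<And>k. k < n \<Longrightarrow> w k = w' k) \<Longrightarrow> prodm S w n = prodm S w' n"
  by (induction n) auto

text \<open>The letters of the right factor come first, since later letters multiply on the left. It
  makes the products over arbitrary finite words a semigroup.\<close>

lemma prodm_concat:
  "prodm S w m ** prodm S w' n = prodm S (\<lambda>k. if k < n then w' k else w (k - n)) (n + m)"
  unfolding prodm_add by (intro arg_cong2[of _ _ _ _ "(**)"] prodm_cong) auto

lemma prodm_Suc_left: "prodm S w (Suc n) = prodm S (\<lambda>k. w (Suc k)) n ** S (w 0)"
  using prodm_add[of S w 1 n] by simp

text \<open>Invariance concerns every letter, because the irreducibility argument uses all finite
  words and not just those occurring in \<open>L\<close>.\<close>

definition invariant_subspace :: "('i \<Rightarrow> complex^'d^'d) \<Rightarrow> (complex^'d) set \<Rightarrow> bool" where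
  "invariant_subspace S V \<longleftrightarrow> vec.subspace V \<and> (\<forall>i. \<forall>v\<in>V. S i *v v \<in> V)"

text \<open>\<open>P\<close> projects \<open>W\<close> onto a complement of \<open>V\<close>, so \<open>P ** S i ** P\<close> represents
  the action of \<open>S i\<close> on the quotient of \<open>W\<close> by \<open>V\<close>.\<close>

locale quotient_block =
  fixes S :: "'i \<Rightarrow> complex^'d^'d" and V W P
  assumes V_inv: "invariant_subspace S V" and W_inv: "invariant_subspace S W"
    and P_in: "\<And>x. P *v x \<in> W" and P_diff: "\<And>x. x \<in> W \<Longrightarrow> x - P *v x \<in> V"
    and P_0: "\<And>x. x \<in> V \<Longrightarrow> P *v x = 0" and P_idem: "P ** P = P"
begin

abbreviation T :: "'i \<Rightarrow> complex^'d^'d" where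
  "T i \<equiv> P ** S i ** P"

lemma subspaces: "vec.subspace V" "vec.subspace W"
  using V_inv W_inv by (auto simp: invariant_subspace_def)

lemma S_in: "x \<in> V \<Longrightarrow> S i *v x \<in> V" "x \<in> W \<Longrightarrow> S i *v x \<in> W"
  using V_inv W_inv by (auto simp: invariant_subspace_def)

lemma prodm_in: "x \<in> V \<Longrightarrow> prodm S w n *v x \<in> V" "x \<in> W \<Longrightarrow> prodm S w n *v x \<in> W"
  by (induction n) (auto simp: matrix_vector_mul_assoc[symmetric] S_in)

lemma P_P: "P *v (P *v x) = P *v x"
  by (simp add: matrix_vector_mul_assoc P_idem)

text \<open>The difference of x and P x lies in \<open>V\<close>, stays there under
  \<open>A\<close>, and is killed by \<open>P\<close>.\<close>

lemma P_absorb: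
  assumes "\<And>v. v \<in> V \<Longrightarrow> A *v v \<in> V" "x \<in> W"
  shows "P *v (A *v (P *v x)) = P *v (A *v x)"
proof -
  have "P *v (A *v (x - P *v x)) = 0" using assms by (intro P_0 assms(1) P_diff)
  then show ?thesis by (simp add: matrix_vector_mult_diff_distrib)
qed

lemma P_prodm:
  assumes "x \<in> W"
  shows "P *v (prodm S w n *v x) = prodm T w n *v (P *v x)"
proof (induction n)
  case (Suc n)
  have "P *v (prodm S w (Suc n) *v x) = P *v (S (w n) *v (P *v (prodm S w n *v x)))"
    using prodm_in(2)[OF assms] by (simp add: P_absorb S_in matrix_vector_mul_assoc[symmetric])
  also have "\<dots> = T (w n) *v (P *v (prodm S w n *v x))"
    by (simp add: matrix_vector_mul_assoc[symmetric] P_P)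
  finally show ?case using Suc by (simp add: matrix_vector_mul_assoc[symmetric])
qed simp

text \<open>The length is positive because the empty product would give \<open>mat 1\<close> on the
  left and \<open>P\<close> on the right.\<close>

lemma prodm_T: "prodm T w (Suc n) = P ** prodm S w (Suc n) ** P"
proof -
  have "prodm T w (Suc n) ** P = prodm T w (Suc n)"
    by (simp add: prodm_Suc_left matrix_mul_assoc[symmetric] P_idem del: prodm.simps)
  then have "prodm T w (Suc n) *v x = P *v (prodm S w (Suc n) *v (P *v x))" for x
    using P_prodm[OF P_in, of w "Suc n" x] by (metis P_P matrix_vector_mul_assoc)
  then show ?thesis by (simp add: matrix_eq matrix_vector_mul_assoc[symmetric] del: prodm.simps)
qed

lemma spec_rad_compression_le: "spec_rad (P ** prodm S w n ** P) \<le> spec_rad (prodm S w n)"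
proof -
  have "norm c \<le> spec_rad (prodm S w n)" if c: "is_eigval (P ** prodm S w n ** P) c" for c
  proof (cases "c = 0")
    case False
    have "is_eigval (prodm S w n) c"
      by (rule eigval_compression[OF subspaces(1) _ _ P_in P_diff P_0 P_idem c False])
         (simp_all add: prodm_in)
    then show ?thesis by (rule norm_eigval_le_spec_rad)
  qed (simp add: spec_rad_nonneg)
  then show ?thesis by (simp add: spec_rad_le_iff)
qed

text \<open>The compressions form a semigroup with unit \<open>P\<close>, and their traces are
  bounded by the dimension. For transitivity, the vectors of \<open>W\<close> whose projection is
  reachable from x form an invariant subspace that contains \<open>V\<close> and also x, which is
  not in \<open>V\<close>; by irreducibility it is all of \<open>W\<close>.\<close>

lemma bounded_compressions:
  assumes sub: "V \<subseteq> W"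
    and irred: "\<And>X. invariant_subspace S X \<Longrightarrow> V \<subseteq> X \<Longrightarrow> X \<subseteq> W \<Longrightarrow> X = V \<or> X = W"
    and rad: "\<And>w n. spec_rad (prodm S w n) \<le> 1"
  shows "bounded {P ** prodm S w n ** P | w n. True}" (is "bounded ?H")
proof (rule bounded_irreducible_semigroup)
  have "P ** prodm S (\<lambda>_. undefined) 0 ** P = P" by (simp add: P_idem)
  then show PH: "P \<in> ?H" by (smt (verit) mem_Collect_eq)
  show "P ** h = h" "h ** P = h" if "h \<in> ?H" for h
    using that by (auto simp: matrix_mul_assoc P_idem) (simp add: matrix_mul_assoc[symmetric] P_idem)
  show mult: "g ** h \<in> ?H" if gh: "g \<in> ?H" "h \<in> ?H" for g h
  proof -
    obtain w m w' n where g: "g = P ** prodm S w m ** P" and h: "h = P ** prodm S w' n ** P"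
      using gh by blast
    have "g ** h = P ** (prodm S w m ** prodm S w' n) ** P"
      by (simp add: matrix_eq g h matrix_vector_mul_assoc[symmetric] P_P P_absorb prodm_in P_in)
    then show ?thesis by (auto simp: prodm_concat)
  qed
  show "norm (trace g) \<le> CARD('d) * 1" if g: "g \<in> ?H" for g
    using g order_trans[OF spec_rad_compression_le rad] by (intro norm_trace_le) auto
  show "\<exists>A\<in>generated_algebra ?H. A *v x = y" if x: "x \<noteq> 0" "P *v x = x" and y: "P *v y = y" for x y
  proof -
    define X where "X = {z \<in> W. \<exists>A\<in>generated_algebra ?H. A *v x = P *v z}"
    have zero: "mat 0 ** P \<in> generated_algebra ?H" by (intro generated_algebra.scale generated_algebra.base PH)
    have VX: "V \<subseteq> X"
    proof
      fix v assume v: "v \<in> V"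
      have "(mat 0 ** P) *v x = P *v v" using P_0[OF v] by (simp add: matrix_vector_mul_assoc[symmetric] mat_vector_mult)
      then show "v \<in> X" using zero v sub unfolding X_def by blast
    qed
    have "vec.subspace X"
    proof (rule vec.subspaceI)
      show "0 \<in> X" using VX vec.subspace_0[OF subspaces(1)] by blast
    next
      fix a b assume "a \<in> X" "b \<in> X"
      then obtain A B where "A \<in> generated_algebra ?H" "A *v x = P *v a" "B \<in> generated_algebra ?H" "B *v x = P *v b" "a \<in> W" "b \<in> W"
        by (auto simp: X_def)
      moreover from this have "(A + B) *v x = P *v (a + b)"
        by (simp add: matrix_vector_mult_add_rdistrib matrix_vector_right_distrib)
      ultimately show "a + b \<in> X" unfolding X_def
        using vec.subspace_add[OF subspaces(2)] generated_algebra.add by blast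
    next
      fix c a assume "a \<in> X"
      then obtain A where "A \<in> generated_algebra ?H" "A *v x = P *v a" "a \<in> W"
        by (auto simp: X_def)
      moreover from this have "(mat c ** A) *v x = P *v (c *s a)"
        by (simp add: matrix_vector_mul_assoc[symmetric] mat_vector_mult vec.scale)
      ultimately show "c *s a \<in> X" unfolding X_def
        using vec.subspace_scale[OF subspaces(2)] generated_algebra.scale by blast
    qed
    moreover have "S i *v a \<in> X" if a: "a \<in> X" for i a
    proof -
      obtain A where A: "A \<in> generated_algebra ?H" "A *v x = P *v a" "a \<in> W"
        using a by (auto simp: X_def)
      have "T i = P ** prodm S (\<lambda>_. i) 1 ** P" by simp
      then have "T i \<in> ?H" by blast
      then have "T i ** A \<in> generated_algebra ?H"
        using generated_algebra_mult[OF mult generated_algebra.base A(1)] by blast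
      moreover have "(T i ** A) *v x = P *v (S i *v a)"
        using A by (simp add: matrix_vector_mul_assoc[symmetric] P_P P_absorb S_in)
      ultimately show ?thesis using A(3) S_in(2) by (auto simp: X_def)
    qed
    ultimately have "invariant_subspace S X" by (simp add: invariant_subspace_def)
    moreover have "X \<subseteq> W" by (auto simp: X_def)
    ultimately have "X = V \<or> X = W" using irred VX by blast
    moreover have "x \<in> W" using P_in[of x] x(2) by simp
    then have "x \<in> X" unfolding X_def using generated_algebra.base[OF PH] by blast
    moreover have "x \<notin> V" using P_0 x by auto
    ultimately have "y \<in> X" using P_in[of y] y by auto
    then show ?thesis using y by (auto simp: X_def)
  qed
qed

text \<open>The component of \<open>prodm S w n *v x\<close> in \<open>V\<close> is a Duhamel sum: at every step the part in the
  complement, which decays, feeds a new vector into \<open>V\<close>, and these vectors decay from then on.\<close>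

lemma quotient_decay:
  assumes L: "shift_plus ` L \<subseteq> L" and B: "\<And>i. norm (S i) \<le> B"
    and decV: "\<And>w n v. w \<in> L \<Longrightarrow> v \<in> V \<Longrightarrow> norm (prodm S w n *v v) \<le> C * r ^ n * norm v"
    and decT: "\<And>w n. w \<in> L \<Longrightarrow> norm (prodm T w n) \<le> C * r ^ n"
    and C: "0 \<le> C" and r: "0 < r"
  obtains D where "0 \<le> D"
    "\<And>w n x. w \<in> L \<Longrightarrow> x \<in> W \<Longrightarrow> norm (prodm S w n *v x) \<le> D * (real n + 1) * r ^ n * norm x"
proof -
  define p where "p = norm P"
  \<comment> \<open>The first summand bounds the initial component in \<open>V\<close>, the second
    one Duhamel term. The division by \<open>r\<close> makes up for the one step in which that term
    is created.\<close>
  define D where "D = C * (1 + p) + C * (1 + p) * B * C * p / r"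
  have B0: "0 \<le> B" using B norm_ge_zero order_trans by blast
  have p: "0 \<le> p" by (simp add: p_def)
  have D: "0 \<le> D" using C p B0 r by (simp add: D_def)
  have D1: "C * (1 + p) \<le> D" using C p B0 r by (simp add: D_def)
  have D2: "C * (1 + p) * B * C * p \<le> D * r" using C p B0 r by (simp add: D_def field_simps)
  have Px: "norm (x - P *v x) \<le> (1 + p) * norm x" for x
    using norm_triangle_ineq4[of x "P *v x"] norm_matrix_vector_mult_le[of P x]
    by (simp add: p_def algebra_simps)
  have "norm (prodm S w n *v x) \<le> (D + C * p) * (real n + 1) * r ^ n * norm x"
    if w: "w \<in> L" and x: "x \<in> W" for w n x
  proof -
    define y where "y m = prodm S w m *v x" for m
    define v where "v m = y m - P *v y m" for m
    have wL: "(\<lambda>j. w (m + j)) \<in> L" for m using shift_invariant[OF L w] .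
    have yW: "y m \<in> W" for m using prodm_in(2)[OF x] by (simp add: y_def)
    have vV: "v m \<in> V" for m using P_diff[OF yW] by (simp add: v_def)
    have u: "norm (P *v y m) \<le> C * p * r ^ m * norm x" for m
    proof -
      have "norm (P *v y m) \<le> norm (prodm T w m) * norm (P *v x)"
        unfolding y_def P_prodm[OF x] by (rule norm_matrix_vector_mult_le)
      also have "\<dots> \<le> (C * r ^ m) * (p * norm x)"
        using decT[OF w] C r norm_matrix_vector_mult_le[of P x] by (intro mult_mono) (auto simp: p_def)
      finally show ?thesis by (simp add: mult_ac)
    qed
    \<comment> \<open>The induction on m carries the k letters still to come, so each vector newly
      fed into \<open>V\<close> is estimated over its entire future.\<close>
    have v: "norm (prodm S (\<lambda>j. w (m + j)) k *v v m) \<le> D * (real m + 1) * r ^ (m + k) * norm x" for m k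
    proof (induction m arbitrary: k)
      case 0
      have "norm (prodm S (\<lambda>j. w (0 + j)) k *v v 0) \<le> C * r ^ k * norm (v 0)"
        by (rule decV[OF wL vV])
      also have "\<dots> \<le> C * r ^ k * ((1 + p) * norm x)"
        using C r Px[of x] by (intro mult_left_mono) (auto simp: v_def y_def)
      also have "\<dots> = C * (1 + p) * (r ^ k * norm x)" by simp
      also have "\<dots> \<le> D * (r ^ k * norm x)" using r by (intro mult_right_mono D1) auto
      finally show ?case by simp
    next
      case (Suc m)
      \<comment> \<open>The part that the complement feeds into \<open>V\<close> at step m.\<close>
      define g where "g = S (w m) *v (P *v y m) - P *v (S (w m) *v (P *v y m))"
      have y': "y (Suc m) = S (w m) *v v m + S (w m) *v (P *v y m)"
        by (simp add: y_def v_def matrix_vector_mul_assoc[symmetric] matrix_vector_right_distrib[symmetric])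
      have v': "v (Suc m) = S (w m) *v v m + g"
        using P_0[OF S_in(1)[OF vV]] unfolding v_def[of "Suc m"] y'
        by (simp add: g_def matrix_vector_right_distrib)
      have gV: "g \<in> V" unfolding g_def by (intro P_diff S_in P_in)
      have "norm g \<le> (1 + p) * norm (S (w m) *v (P *v y m))" unfolding g_def by (rule Px)
      also have "norm (S (w m) *v (P *v y m)) \<le> norm (S (w m)) * norm (P *v y m)"
        by (rule norm_matrix_vector_mult_le)
      also have "\<dots> \<le> B * (C * p * r ^ m * norm x)"
        using B u B0 by (rule mult_mono) simp
      finally have ng: "norm g \<le> (1 + p) * (B * (C * p * r ^ m * norm x))"
        using p by (simp add: mult_left_mono)
      have "prodm S (\<lambda>j. w (m + j)) (Suc k) = prodm S (\<lambda>j. w (Suc m + j)) k ** S (w m)"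
        by (subst prodm_Suc_left) simp
      then have "prodm S (\<lambda>j. w (Suc m + j)) k *v v (Suc m)
          = prodm S (\<lambda>j. w (m + j)) (Suc k) *v v m + prodm S (\<lambda>j. w (Suc m + j)) k *v g"
        by (simp add: v' matrix_vector_right_distrib matrix_vector_mul_assoc del: prodm.simps)
      then have "norm (prodm S (\<lambda>j. w (Suc m + j)) k *v v (Suc m))
          \<le> norm (prodm S (\<lambda>j. w (m + j)) (Suc k) *v v m) + norm (prodm S (\<lambda>j. w (Suc m + j)) k *v g)"
        by (simp add: norm_triangle_ineq del: prodm.simps)
      also have "\<dots> \<le> D * (real m + 1) * r ^ (m + Suc k) * norm x + C * r ^ k * norm g"
        using Suc.IH[of "Suc k"] decV[OF wL gV, of "Suc m" k] by (intro add_mono)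
      also have "C * r ^ k * norm g \<le> C * r ^ k * ((1 + p) * (B * (C * p * r ^ m * norm x)))"
        using C r by (intro mult_left_mono ng) auto
      also have "\<dots> = (C * (1 + p) * B * C * p) * (r ^ (m + k) * norm x)"
        by (simp add: power_add mult_ac)
      also have "\<dots> \<le> (D * r) * (r ^ (m + k) * norm x)"
        using r by (intro mult_right_mono D2) auto
      finally show ?case by (simp add: algebra_simps)
    qed
    have "norm (y n) \<le> norm (v n) + norm (P *v y n)"
      using norm_triangle_ineq[of "v n" "P *v y n"] by (simp add: v_def)
    also have "\<dots> \<le> D * (real n + 1) * r ^ n * norm x + C * p * r ^ n * norm x"
      using v[of n 0] u[of n] by simp
    also have "C * p * r ^ n * norm x \<le> (C * p * r ^ n * norm x) * (real n + 1)"
      using C p r mult_left_mono[of 1 "real n + 1" "C * p * r ^ n * norm x"] by simp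
    finally show ?thesis by (simp add: y_def algebra_simps)
  qed
  moreover have "0 \<le> D + C * p" using D C p by simp
  ultimately show ?thesis using that by blast
qed

end

text \<open>Bernoulli's inequality for s / r = 1 + q bounds 1 + n q by (s / r)^n, and n + 1 is at
  most (1 + 1 / q) (1 + n q).\<close>

lemma linear_times_power_le:
  assumes "0 < r" "r < (s :: real)"
  shows "(real n + 1) * r ^ n \<le> (1 + r / (s - r)) * s ^ n"
proof -
  define q where "q = s / r - 1"
  have q: "0 < q" using assms by (simp add: q_def)
  have "1 + real n * q \<le> (1 + q) ^ n" using q by (intro Bernoulli_inequality) simp
  also have "1 + q = s / r" by (simp add: q_def)
  finally have "(1 + real n * q) * r ^ n \<le> s ^ n" using assms by (simp add: power_divide field_simps)
  moreover have "real n + 1 \<le> (1 + 1 / q) * (1 + real n * q)" using q by (simp add: field_simps)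
  moreover have "1 / q = r / (s - r)" using assms by (simp add: q_def field_simps)
  ultimately have "(real n + 1) * r ^ n \<le> (1 + r / (s - r)) * ((1 + real n * q) * r ^ n)"
    using assms by (metis mult.assoc mult_right_mono zero_le_power less_imp_le)
  also have "\<dots> \<le> (1 + r / (s - r)) * s ^ n"
    using \<open>(1 + real n * q) * r ^ n \<le> s ^ n\<close> assms by (intro mult_left_mono) auto
  finally show ?thesis .
qed

section \<open>Enlarging decaying invariant subspaces up to the whole space\<close>

definition decays_on :: "('i \<Rightarrow> complex^'d^'d) \<Rightarrow> (nat \<Rightarrow> 'i) set \<Rightarrow> (complex^'d) set \<Rightarrow> bool" where
  "decays_on S L V \<longleftrightarrow> (\<exists>C r. 0 \<le> C \<and> 0 < r \<and> r < 1 \<and>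
     (\<forall>w\<in>L. \<forall>n. \<forall>v\<in>V. norm (prodm S w n *v v) \<le> C * r ^ n * norm v))"

text \<open>Least dimension of \<open>W\<close> among the invariant subspaces strictly above
  \<open>V\<close> makes the quotient irreducible, so the results on bounded semigroups apply to the
  compressions.\<close>

lemma decaying_subspace_extend:
  fixes S :: "'i::metric_space \<Rightarrow> complex^'d^'d"
  assumes cont: "continuous_on UNIV S" and bdd: "bounded (range S)"
    and L: "compact L" "shift_plus ` L \<subseteq> L"
    and rad: "\<And>w n. spec_rad (prodm S w n) \<le> 1"
    and rad_L: "\<And>w n. w \<in> L \<Longrightarrow> N \<le> n \<Longrightarrow> spec_rad (prodm S w n) \<le> \<gamma>" and "\<gamma> < 1"
    and V: "invariant_subspace S V" "decays_on S L V" "V \<noteq> UNIV"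
  obtains W where "invariant_subspace S W" "decays_on S L W" "vec.dim V < vec.dim W"
proof -
  have sV: "vec.subspace V" using V(1) by (simp add: invariant_subspace_def)
  have "invariant_subspace S UNIV \<and> V \<subset> UNIV" using V(3) by (auto simp: invariant_subspace_def)
  then obtain W where W: "invariant_subspace S W" "V \<subset> W"
    and min: "\<And>X. invariant_subspace S X \<Longrightarrow> V \<subset> X \<Longrightarrow> vec.dim W \<le> vec.dim X"
    using ex_has_least_nat[of "\<lambda>X. invariant_subspace S X \<and> V \<subset> X" UNIV vec.dim] by blast
  have sW: "vec.subspace W" using W(1) by (simp add: invariant_subspace_def)
  obtain P where P: "\<And>x. P *v x \<in> W" "\<And>x. x \<in> W \<Longrightarrow> x - P *v x \<in> V"
    "\<And>x. x \<in> V \<Longrightarrow> P *v x = 0" "P ** P = P"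
    using ex_projection_modulo[OF sV sW] W(2) by (metis psubset_imp_subset)
  interpret quotient_block S V W P
    using V(1) W(1) P by unfold_locales auto
  have "X = V \<or> X = W" if X: "invariant_subspace S X" "V \<subseteq> X" "X \<subseteq> W" for X
  proof (cases "X = V")
    case False
    have "vec.subspace X" using X(1) by (simp add: invariant_subspace_def)
    then show ?thesis using vec.subspace_dim_equal[of X W] sW X min False by blast
  qed simp
  then have "bounded {P ** prodm S w n ** P | w n. True}"
    using W(2) rad by (intro bounded_compressions) auto
  then obtain K where K: "\<And>w n. norm (P ** prodm S w n ** P) \<le> K"
    unfolding bounded_iff by blast
  \<comment> \<open>The maximum accounts for the empty product, which is not a compression;
    \<open>max 1 N\<close> below excludes it for the same reason.\<close>
  have T_bound: "norm (prodm T w n) \<le> max K (norm (mat 1 :: complex^'d^'d))" for w n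
  proof (cases n)
    case (Suc m)
    show ?thesis unfolding Suc prodm_T using K[of w "Suc m"] by (rule max.coboundedI1)
  qed simp
  have T_rad: "spec_rad (prodm T w n) \<le> \<gamma>" if "w \<in> L" "max 1 N \<le> n" for w n
  proof -
    obtain m where m: "n = Suc m" using \<open>max 1 N \<le> n\<close> by (cases n) auto
    show ?thesis unfolding m prodm_T
      using order_trans[OF spec_rad_compression_le rad_L] that m by (simp del: prodm.simps)
  qed
  have T_cont: "continuous_on UNIV T"
    by (intro bounded_bilinear.continuous_on[OF bounded_bilinear_matrix_matrix_mult] continuous_on_const cont)
  obtain B where B: "\<And>i. norm (S i) \<le> B" using bdd by (auto simp: bounded_iff)
  have "norm (T i) \<le> K" for i using K[of "\<lambda>_. i" 1] by simp
  then have T_bdd: "bounded (range T)" by (auto simp: bounded_iff)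
  have "prodm T w \<longlonglongrightarrow> 0" if "w \<in> L" for w
    by (rule prodm_tendsto_0_of_spec_rad[OF L(2) T_bound _ \<open>\<gamma> < 1\<close> that]) (rule T_rad)
  then obtain C1 r1 where 1: "0 < C1" "0 < r1" "r1 < 1"
    "\<And>w n. w \<in> L \<Longrightarrow> norm (prodm T w n) \<le> C1 * r1 ^ n"
    using uniform_exponential_decay[OF T_cont T_bdd L] by metis
  obtain C2 r2 where 2: "0 \<le> C2" "0 < r2" "r2 < 1"
    "\<And>w n v. w \<in> L \<Longrightarrow> v \<in> V \<Longrightarrow> norm (prodm S w n *v v) \<le> C2 * r2 ^ n * norm v"
    using V(2) unfolding decays_on_def by blast
  define C where "C = max C1 C2"
  define r where "r = max r1 r2"
  have r: "0 < r" "r < 1" and C: "0 \<le> C" using 1 2 by (auto simp: C_def r_def)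
  have le: "C1 * r1 ^ n \<le> C * r ^ n" "C2 * r2 ^ n \<le> C * r ^ n" for n
    using 1 2 C by (auto simp: C_def r_def intro!: mult_mono power_mono)
  obtain D where D: "0 \<le> D"
    "\<And>w n x. w \<in> L \<Longrightarrow> x \<in> W \<Longrightarrow> norm (prodm S w n *v x) \<le> D * (real n + 1) * r ^ n * norm x"
  proof (rule quotient_decay[OF L(2) B _ _ C r(1)])
    show "norm (prodm T w n) \<le> C * r ^ n" if "w \<in> L" for w n
      using 1(4)[OF that] le(1) by (rule order_trans)
    show "norm (prodm S w n *v v) \<le> C * r ^ n * norm v" if "w \<in> L" "v \<in> V" for w n v
      using 2(4)[OF that] mult_right_mono[OF le(2) norm_ge_zero] by (rule order_trans)
  qed blast
  \<comment> \<open>A rate strictly between \<open>r\<close> and 1 absorbs the linear factor of the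
    Duhamel estimate.\<close>
  define s where "s = (1 + r) / 2"
  have s: "r < s" "s < 1" using r by (auto simp: s_def)
  define E where "E = 1 + r / (s - r)"
  have E: "0 \<le> E" using r s by (simp add: E_def)
  have "norm (prodm S w n *v x) \<le> (D * E) * s ^ n * norm x" if "w \<in> L" "x \<in> W" for w n x
  proof -
    have "norm (prodm S w n *v x) \<le> D * ((real n + 1) * r ^ n) * norm x"
      using D(2)[OF that] by (simp add: mult.assoc)
    also have "\<dots> \<le> D * (E * s ^ n) * norm x"
      unfolding E_def using D(1) r s by (intro mult_left_mono mult_right_mono linear_times_power_le) auto
    finally show ?thesis by (simp add: mult.assoc)
  qed
  moreover have "0 \<le> D * E" "0 < s" using D(1) E r s by auto
  ultimately have "decays_on S L W" using s(2) unfolding decays_on_def by blast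
  moreover have "vec.dim V < vec.dim W"
    using W(2) sV sW vec.dim_psubset[of V W] by (simp add: vec.span_eq_iff[THEN iffD2])
  ultimately show ?thesis using that W(1) by blast
qed

lemma prodm_tendsto_0_of_spec_rad_le:
  fixes S :: "'i::metric_space \<Rightarrow> complex^'d^'d"
  assumes cont: "continuous_on UNIV S" and bdd: "bounded (range S)"
    and L: "compact L" "shift_plus ` L \<subseteq> L"
    and rad: "\<And>w n. spec_rad (prodm S w n) \<le> 1"
    and rad_L: "\<And>w n. w \<in> L \<Longrightarrow> N \<le> n \<Longrightarrow> spec_rad (prodm S w n) \<le> \<gamma>" and "\<gamma> < 1"
    and w: "w \<in> L"
  shows "prodm S w \<longlonglongrightarrow> 0"
proof -
  let ?Q = "\<lambda>V. invariant_subspace S V \<and> decays_on S L V"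
  have "decays_on S L {0}" unfolding decays_on_def by (intro exI[of _ 0] exI[of _ "1/2"]) auto
  then have "?Q {0}" by (simp add: invariant_subspace_def)
  moreover have "\<forall>V. ?Q V \<longrightarrow> vec.dim V < Suc CARD('d)"
    by (simp add: le_imp_less_Suc dim_subset_UNIV_cart_gen)
  ultimately obtain V where V: "?Q V" and max: "\<And>W. ?Q W \<Longrightarrow> vec.dim W \<le> vec.dim V"
    using Lattices_Big.ex_has_greatest_nat[of ?Q "{0}" vec.dim "Suc CARD('d)"] by blast
  have "V = UNIV"
  proof (rule ccontr)
    assume "V \<noteq> UNIV"
    then obtain W where "?Q W" "vec.dim V < vec.dim W"
      using decaying_subspace_extend[OF cont bdd L rad rad_L \<open>\<gamma> < 1\<close>, where V = V] V by metis
    then show False using max[of W] by simp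
  qed
  then obtain C r where C: "0 < r" "r < 1" "\<And>n v. norm (prodm S w n *v v) \<le> C * r ^ n * norm v"
    using V w unfolding decays_on_def by blast
  have "(\<lambda>n. prodm S w n *v v) \<longlonglongrightarrow> 0" for v
  proof (rule Lim_null_comparison)
    show "\<forall>\<^sub>F n in sequentially. norm (prodm S w n *v v) \<le> C * r ^ n * norm v" using C by simp
    show "(\<lambda>n. C * r ^ n * norm v) \<longlonglongrightarrow> 0"
      using C by (intro tendsto_mult_left_zero tendsto_mult_right_zero LIMSEQ_power_zero) simp
  qed
  \<comment> \<open>Applying the products to the unit vectors recovers their columns.\<close>
  then have "(\<lambda>n. (prodm S w n *v axis j 1) $ i) \<longlonglongrightarrow> 0" for i j
    using tendsto_vec_nth by fastforce
  then have "(\<lambda>n. prodm S w n $ i $ j) \<longlonglongrightarrow> 0" for i j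
    by (simp add: matrix_vector_mult_def axis_def if_distrib[where f = "\<lambda>x. a * x" for a] cong: if_cong)
  then show ?thesis by (intro vec_tendstoI) simp
qed

text \<open>The powers of the product along a finite word are the products along its periodic repetition.\<close>

lemma spec_rad_prodm_le_1:
  fixes S :: "'i \<Rightarrow> complex^'d^'d"
  assumes "gen_spec_rad S UNIV = 1"
  shows "spec_rad (prodm S w n) \<le> 1"
proof (cases "n = 0")
  case True
  have "spec_rad (mat 1 :: complex^'d^'d) \<le> 1"
    by (auto simp: spec_rad_le_iff is_eigval_def) (metis vec.scale_cancel_right vec.scale_one norm_one order_refl)
  then show ?thesis using True by simp
next
  case False
  then have n: "0 < n" by simp
  show ?thesis unfolding spec_rad_le_iff
  proof (intro allI impI)
    fix c assume "is_eigval (prodm S w n) c"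
    then obtain v where v: "v \<noteq> 0" "prodm S w n *v v = c *s v" by (auto simp: is_eigval_def)
    define w' where "w' k = w (k mod n)" for k
    have pow: "prodm S w' (n * m) *v v = c ^ m *s v" for m
    proof (induction m)
      case (Suc m)
      have "prodm S (\<lambda>k. w' (n * m + k)) n = prodm S w n"
        by (rule prodm_cong) (simp add: w'_def)
      then have "prodm S w' (n * Suc m) = prodm S w n ** prodm S w' (n * m)"
        using prodm_add[of S w' "n * m" n] by (simp add: add.commute)
      then show ?case using Suc v(2) by (simp add: matrix_vector_mul_assoc[symmetric] vec.scale mult.commute)
    qed simp
    let ?g = "\<lambda>k. SUP u\<in>UNIV. ereal (spec_rad (prodm S u k) powr (1 / real k))"
    have ge: "ereal (norm c powr (1 / real n)) \<le> ?g (n * m)" if "0 < m" for m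
    proof -
      have "is_eigval (prodm S w' (n * m)) (c ^ m)" using v(1) pow by (auto simp: is_eigval_def)
      then have "norm c ^ m \<le> spec_rad (prodm S w' (n * m))"
        by (metis norm_eigval_le_spec_rad norm_power)
      then have "(norm c ^ m) powr (1 / real (n * m)) \<le> spec_rad (prodm S w' (n * m)) powr (1 / real (n * m))"
        by (intro powr_mono2) auto
      moreover have "(norm c ^ m) powr (1 / real (n * m)) = norm c powr (1 / real n)"
        using that by (cases "c = 0") (auto simp: powr_realpow[symmetric] powr_powr)
      ultimately show ?thesis by (intro SUP_upper2[of w']) auto
    qed
    \<comment> \<open>\<open>Suc m\<close> keeps the length positive, as \<open>ge\<close> requires,
      and the lengths form a strictly increasing subsequence.\<close>
    have "ereal (norm c powr (1 / real n)) \<le> limsup (?g \<circ> (\<lambda>m. n * Suc m))"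
      unfolding comp_def by (intro le_Limsup always_eventually allI ge) auto
    also have "\<dots> \<le> limsup ?g"
      by (rule limsup_subseq_mono) (use n in \<open>auto simp: strict_mono_def\<close>)
    also have "\<dots> = 1" using assms by (simp add: gen_spec_rad_def)
    finally have "norm c powr (1 / real n) \<le> 1" by simp
    then show "norm c \<le> 1"
      using n by (metis (no_types) gr_one_powr not_le of_nat_0_less_iff zero_less_divide_1_iff)
  qed
qed

section \<open>Decay, generalized spectral radius and uniform bounds\<close>

text \<open>The spectral radius is at most the norm, and the n-th root of C r^n tends to r.\<close>

lemma gen_spec_rad_less_1_of_decay:
  assumes "0 < C" "0 < r" "r < 1" "\<And>w n. w \<in> L \<Longrightarrow> norm (prodm S w n) \<le> C * r ^ n"
  shows "gen_spec_rad S L < 1"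
proof -
  let ?g = "\<lambda>k. SUP u\<in>L. ereal (spec_rad (prodm S u k) powr (1 / real k))"
  have "(\<lambda>n. C powr (1 / real n) * r) \<longlonglongrightarrow> C powr 0 * r"
    using \<open>0 < C\<close> by (intro tendsto_intros lim_1_over_n) auto
  then have lim: "(\<lambda>n. ereal (C powr (1 / real n) * r)) \<longlonglongrightarrow> ereal r" using \<open>0 < C\<close> by simp
  have "?g n \<le> ereal (C powr (1 / real n) * r)" if n: "0 < n" for n
  proof (intro SUP_least)
    fix u assume "u \<in> L"
    then have "spec_rad (prodm S u n) \<le> C * r ^ n" using assms(4) spec_rad_le_norm order_trans by blast
    then have "spec_rad (prodm S u n) powr (1 / real n) \<le> (C * r ^ n) powr (1 / real n)"
      by (intro powr_mono2) (auto simp: spec_rad_nonneg)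
    also have "\<dots> = C powr (1 / real n) * r"
      using n assms(1,2) by (simp add: powr_mult powr_realpow[symmetric] powr_powr)
    finally show "ereal (spec_rad (prodm S u n) powr (1 / real n)) \<le> ereal (C powr (1 / real n) * r)" by simp
  qed
  then have "limsup ?g \<le> limsup (\<lambda>n. ereal (C powr (1 / real n) * r))"
    by (intro Limsup_mono eventually_mono[OF eventually_gt_at_top[of 0]])
  also have "\<dots> = ereal r" using lim_imp_Limsup[OF _ lim] by simp
  finally show ?thesis unfolding gen_spec_rad_def using \<open>r < 1\<close> by (simp add: le_less_trans)
qed

text \<open>For \<gamma> strictly between the limsup and 1, the spectral radii are eventually at
  most \<gamma>^n, hence at most \<gamma>.\<close>

lemma uniform_spec_rad_bound_of_gen_spec_rad_less_1:
  assumes "gen_spec_rad S L < 1"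
  shows "\<exists>\<gamma>::real. 0 < \<gamma> \<and> \<gamma> < 1 \<and> (\<exists>N\<ge>1. \<forall>n\<ge>N. \<forall>w\<in>L. spec_rad (prodm S w n) \<le> \<gamma>)"
proof -
  let ?g = "\<lambda>k. SUP u\<in>L. ereal (spec_rad (prodm S u k) powr (1 / real k))"
  \<comment> \<open>The maximum with 0 forces \<gamma> to be positive.\<close>
  have "max 0 (gen_spec_rad S L) < 1" using assms by simp
  then obtain \<gamma> where \<gamma>: "max 0 (gen_spec_rad S L) < ereal \<gamma>" "ereal \<gamma> < 1"
    using ereal_dense2 by blast
  then have g: "0 < \<gamma>" "\<gamma> < 1" by auto
  have "limsup ?g < ereal \<gamma>" using \<gamma>(1) by (simp add: gen_spec_rad_def)
  then have "\<forall>\<^sub>F n in sequentially. ?g n < ereal \<gamma>" by (rule Limsup_lessD)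
  then obtain N where N: "\<And>n. N \<le> n \<Longrightarrow> ?g n < ereal \<gamma>" by (auto simp: eventually_sequentially)
  have "spec_rad (prodm S w n) \<le> \<gamma>" if n: "max 1 N \<le> n" and w: "w \<in> L" for n w
  proof -
    have "ereal (spec_rad (prodm S w n) powr (1 / real n)) \<le> ?g n" using w by (rule SUP_upper)
    also have "\<dots> < ereal \<gamma>" using N n by simp
    finally have "spec_rad (prodm S w n) powr (1 / real n) \<le> \<gamma>" by simp
    then have "(spec_rad (prodm S w n) powr (1 / real n)) powr real n \<le> \<gamma> powr real n"
      by (intro powr_mono2) auto
    moreover have "(spec_rad (prodm S w n) powr (1 / real n)) powr real n = spec_rad (prodm S w n)"
      using n spec_rad_nonneg[of "prodm S w n"] by (simp add: powr_powr)
    moreover have "\<gamma> powr real n \<le> \<gamma> powr 1" using n g by (intro powr_mono') auto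
    ultimately show ?thesis using g by simp
  qed
  then show ?thesis using g by (intro exI[of _ \<gamma>] conjI exI[of _ "max 1 N"]) auto
qed

theorem theoremB:
  fixes S :: "'i::metric_space \<Rightarrow> complex^'d^'d"
    and \<Lambda> :: "(nat \<Rightarrow> 'i) set"
  assumes "continuous_on UNIV S"
    and "bounded (range S)"
    and "gen_spec_rad S UNIV = 1"
    and "\<Lambda> \<noteq> {}"
    and "compact \<Lambda>"
    and "shift_plus ` \<Lambda> \<subseteq> \<Lambda>"
  shows "((\<forall>w\<in>\<Lambda>. (\<lambda>n. prodm S w n) \<longlonglongrightarrow> 0) \<longleftrightarrow> gen_spec_rad S \<Lambda> < 1)
       \<and> (gen_spec_rad S \<Lambda> < 1 \<longleftrightarrow>
           (\<exists>\<gamma>::real. 0 < \<gamma> \<and> \<gamma> < 1 \<and>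
              (\<exists>N::nat. N \<ge> 1 \<and> (\<forall>n\<ge>N. \<forall>w\<in>\<Lambda>. spec_rad (prodm S w n) \<le> \<gamma>))))"
    (is "(?a \<longleftrightarrow> ?b) \<and> (_ \<longleftrightarrow> ?c)")
proof -
  have ab: ?b if a: ?a
  proof -
    obtain C r where "0 < C" "0 < r" "r < 1" "\<And>w n. w \<in> \<Lambda> \<Longrightarrow> norm (prodm S w n) \<le> C * r ^ n"
      using uniform_exponential_decay[OF assms(1,2,5,6)] a by metis
    then show ?thesis by (rule gen_spec_rad_less_1_of_decay)
  qed
  have bc: ?c if ?b using that by (rule uniform_spec_rad_bound_of_gen_spec_rad_less_1)
  have ca: ?a if c: ?c
  proof -
    obtain \<gamma> N where "\<gamma> < 1" "\<And>n w. N \<le> n \<Longrightarrow> w \<in> \<Lambda> \<Longrightarrow> spec_rad (prodm S w n) \<le> \<gamma>"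
      using c by blast
    \<comment> \<open>The normalization of the unconstrained radius enters here: it bounds the
      spectral radii over all finite words by 1.\<close>
    then show ?thesis
      using prodm_tendsto_0_of_spec_rad_le[OF assms(1,2,5,6) spec_rad_prodm_le_1[OF assms(3)], of N \<gamma>]
      by blast
  qed
  show ?thesis using ab bc ca by blast
qed

end
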